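(* Let $X,Y$ be Polish spaces, $\mu\in\mathcal P(X)$, $\nu\in\mathcal P(Y)$ Borel probability measures, and $c:X\times Y\to[0,+\infty]$ lower semicontinuous such that, for some $\mathcal K<+\infty$, $\sup_{y}\int_X c(x,y)\,d\mu(x)\le\mathcal K$ and $\sup_{x}\int_Y c(x,y)\,d\nu(y)\le\mathcal K$. Let $\varepsilon>0$ and let $(u_\varepsilon,v_\varepsilon)$ be a maximizer of $\mathcal D_\varepsilon$ over $L^1_\mu\times L^1_\nu$ (it exists, is unique up to replacing $(u,v)$ by $(u+a,v-a)$ with $a\in\mathbb R$, and satisfies $u_\varepsilon=v_\varepsilon^{c,\varepsilon}$, $v_\varepsilon=u_\varepsilon^{c,\varepsilon}$ a.e.). Then the measure $\bar\gamma_\varepsilon$ defined by $$d\bar\gamma_\varepsilon(x,y)=e^{\frac{u_\varepsilon(x)+v_\varepsilon(y)-c(x,y)}{\varepsilon}}\,d(\mu\otimes\nu)(x,y)$$ belongs to $\Pi(\mu,\nu)$ and is the unique minimizer of $\mathcal C_\varepsilon$ over $\Pi(\mu,\nu)$. Moreover $$\min_{\gamma\in\Pi(\mu,\nu)}\mathcal C_\varepsilon(\gamma)=\max_{(u,v)\in L^1_\mu\times L^1_\nu}\mathcal D_\varepsilon(u,v).$$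
   Context: $\Pi(\mu,\nu)$ is the set of Borel probability measures on $X\times Y$ with marginals $\mu$ and $\nu$. For $\gamma\in\Pi(\mu,\nu)$, $$\mathcal C_\varepsilon(\gamma)=\int_{X\times Y}c\,d\gamma+\varepsilon\,\mathcal H(\gamma|\mu\otimes\nu),$$ where $\mathcal H(\gamma|\mu\otimes\nu)=\int \rho\log\rho\,d(\mu\otimes\nu)$ if $\gamma\ll\mu\otimes\nu$ with density $\rho$, and $+\infty$ otherwise. For $u\in L^1_\mu$, $v\in L^1_\nu$, $$\mathcal D_\varepsilon(u,v)=\int_X u\,d\mu+\int_Y v\,d\nu-\varepsilon\int_{X\times Y}e^{\frac{u(x)+v(y)-c(x,y)}{\varepsilon}}\,d(\mu\otimes\nu)+\varepsilon\in[-\infty,+\infty),$$ with $e^{-\infty}=0$. The $(c,\varepsilon)$-transforms are $u^{c,\varepsilon}(y)=-\varepsilon\log\int_X e^{\frac{u(x)-c(x,y)}{\varepsilon}}d\mu(x)$ and $v^{c,\varepsilon}(x)=-\varepsilon\log\int_Y e^{\frac{v(y)-c(x,y)}{\varepsilon}}d\nu(y)$. *)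

theory Defs
  imports "HOL-Probability.Probability"
begin

definition lower_semicontinuous ::
    "('a::topological_space \<Rightarrow> 'b::complete_lattice) \<Rightarrow> bool" where
  "lower_semicontinuous f \<longleftrightarrow> (\<forall>z. f z \<le> Liminf (at z) f)"

definition eexp :: "ereal \<Rightarrow> ennreal" where
  "eexp t = (if t = \<infinity> then \<infinity> else if t = -\<infinity> then 0 else ennreal (exp (real_of_ereal t)))"

definition elog :: "ennreal \<Rightarrow> ereal" where
  "elog t = (if t = 0 then -\<infinity> else if t = \<infinity> then \<infinity> else ereal (ln (enn2real t)))"

text \<open>Integral with values in the extended reals, meaningful as soon as the positive or the
  negative part of the integrand has finite integral.\<close>

definition ext_integral :: "'a measure \<Rightarrow> ('a \<Rightarrow> real) \<Rightarrow> ereal" where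
  "ext_integral M f =
    enn2ereal (\<integral>\<^sup>+ z. ennreal (f z) \<partial>M) - enn2ereal (\<integral>\<^sup>+ z. ennreal (- f z) \<partial>M)"

text \<open>For probability measures the negative part of \<open>\<rho> log \<rho>\<close> is bounded by \<open>1 / e\<close>, so the
  extended integral is meaningful; the density is finite almost everywhere, and \<open>ln 0 = 0\<close>
  gives the convention \<open>0 log 0 = 0\<close>.\<close>

definition relative_entropy :: "'a measure \<Rightarrow> 'a measure \<Rightarrow> ereal" where
  "relative_entropy \<gamma> M =
    (if absolutely_continuous M \<gamma>
     then ext_integral M (\<lambda>z. enn2real (RN_deriv M \<gamma> z) * ln (enn2real (RN_deriv M \<gamma> z)))
     else \<infinity>)"

definition couplings ::
    "'a::topological_space measure \<Rightarrow> 'b::topological_space measure \<Rightarrow> ('a \<times> 'b) measure set" where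
  "couplings \<mu> \<nu> = {\<gamma>. prob_space \<gamma> \<and> sets \<gamma> = sets borel \<and>
     distr \<gamma> borel fst = \<mu> \<and> distr \<gamma> borel snd = \<nu>}"

definition entropic_cost ::
    "'a measure \<Rightarrow> 'b measure \<Rightarrow> ('a \<times> 'b \<Rightarrow> ennreal) \<Rightarrow> real \<Rightarrow> ('a \<times> 'b) measure \<Rightarrow> ereal" where
  "entropic_cost \<mu> \<nu> c \<epsilon> \<gamma> =
    enn2ereal (\<integral>\<^sup>+ z. c z \<partial>\<gamma>) + ereal \<epsilon> * relative_entropy \<gamma> (\<mu> \<Otimes>\<^sub>M \<nu>)"

text \<open>Elements of \<open>L\<^sup>1\<close> are represented by everywhere finite integrable functions; equalities
  between them are to be read almost everywhere.\<close>

definition L1 :: "'a measure \<Rightarrow> ('a \<Rightarrow> real) set" where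
  "L1 M = {f. integrable M f}"

definition gibbs_kernel ::
    "('a \<times> 'b \<Rightarrow> ennreal) \<Rightarrow> real \<Rightarrow> ('a \<Rightarrow> real) \<Rightarrow> ('b \<Rightarrow> real) \<Rightarrow> 'a \<times> 'b \<Rightarrow> ennreal" where
  "gibbs_kernel c \<epsilon> u v = (\<lambda>(x, y). eexp ((ereal (u x + v y) - enn2ereal (c (x, y))) / ereal \<epsilon>))"

definition dual_functional ::
    "'a measure \<Rightarrow> 'b measure \<Rightarrow> ('a \<times> 'b \<Rightarrow> ennreal) \<Rightarrow> real \<Rightarrow> ('a \<Rightarrow> real) \<Rightarrow> ('b \<Rightarrow> real) \<Rightarrow> ereal" where
  "dual_functional \<mu> \<nu> c \<epsilon> u v =
    ereal ((\<integral>x. u x \<partial>\<mu>) + (\<integral>y. v y \<partial>\<nu>))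
      - ereal \<epsilon> * enn2ereal (\<integral>\<^sup>+ z. gibbs_kernel c \<epsilon> u v z \<partial>(\<mu> \<Otimes>\<^sub>M \<nu>)) + ereal \<epsilon>"

definition dual_maximizer ::
    "'a measure \<Rightarrow> 'b measure \<Rightarrow> ('a \<times> 'b \<Rightarrow> ennreal) \<Rightarrow> real \<Rightarrow> ('a \<Rightarrow> real) \<Rightarrow> ('b \<Rightarrow> real) \<Rightarrow> bool" where
  "dual_maximizer \<mu> \<nu> c \<epsilon> u v \<longleftrightarrow>
    is_arg_max (\<lambda>(u, v). dual_functional \<mu> \<nu> c \<epsilon> u v) (\<lambda>p. p \<in> L1 \<mu> \<times> L1 \<nu>) (u, v)"

definition transform_fst ::
    "'a measure \<Rightarrow> ('a \<times> 'b \<Rightarrow> ennreal) \<Rightarrow> real \<Rightarrow> ('a \<Rightarrow> real) \<Rightarrow> 'b \<Rightarrow> ereal" where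
  "transform_fst \<mu> c \<epsilon> u y =
    - ereal \<epsilon> * elog (\<integral>\<^sup>+ x. eexp ((ereal (u x) - enn2ereal (c (x, y))) / ereal \<epsilon>) \<partial>\<mu>)"

definition transform_snd ::
    "'b measure \<Rightarrow> ('a \<times> 'b \<Rightarrow> ennreal) \<Rightarrow> real \<Rightarrow> ('b \<Rightarrow> real) \<Rightarrow> 'a \<Rightarrow> ereal" where
  "transform_snd \<nu> c \<epsilon> v x =
    - ereal \<epsilon> * elog (\<integral>\<^sup>+ y. eexp ((ereal (v y) - enn2ereal (c (x, y))) / ereal \<epsilon>) \<partial>\<nu>)"

definition entropic_plan ::
    "'a measure \<Rightarrow> 'b measure \<Rightarrow> ('a \<times> 'b \<Rightarrow> ennreal) \<Rightarrow> real \<Rightarrow> ('a \<Rightarrow> real) \<Rightarrow> ('b \<Rightarrow> real)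
      \<Rightarrow> ('a \<times> 'b) measure" where
  "entropic_plan \<mu> \<nu> c \<epsilon> u v = density (\<mu> \<Otimes>\<^sub>M \<nu>) (gibbs_kernel c \<epsilon> u v)"

end

theory Submission
  imports Defs
begin

text \<open>
  After division by \<open>\<epsilon>\<close> the dual functional is the integral of \<open>u + v\<close> minus the mass of the
  Gibbs density \<open>exp (u + v - C)\<close>. Replacing one potential by the transform of the other does not
  decrease it, and thanks to the bound on the integrals of \<open>C\<close> any pair of bounded potentials can
  be improved to one in a fixed box. On this box the functional is strongly concave, so for a
  maximizing sequence the sums \<open>u + v\<close> are Cauchy in weighted \<open>L\<^sup>1\<close>; a subsequence converges
  almost everywhere, and the limit is a bounded maximizer. It is a fixed point of the transforms, that
  is, its Gibbs density is a coupling. The tangent inequalities of \<open>exp\<close> and of \<open>r log r\<close>, integrated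
  against this coupling and against \<open>\<mu> \<otimes> \<nu>\<close>, then give optimality and uniqueness among all
  integrable potentials and all couplings.
\<close>


text \<open>The cost is not assumed continuous, so its transforms need not form an equicontinuous
  family, and a maximizing sequence has no evident compactness; strong concavity supplies a Cauchy
  property in its place. The concavity modulus is a lower bound for \<open>exp\<close> of the sums,
  which is why a fixed box is needed before any limit is taken. The box comes from Jensen's
  inequality: a transform is at most \<open>K\<close> minus the mean of its argument, whatever the
  size of that argument. Two further obstacles shape the limit. The Gibbs weight vanishes where the
  cost is infinite, but this set is null because the cost has finite integral. And only sums are
  controlled, so the two potentials must be separated by normalising at a reference point. Once a
  bounded solution is known, its plan serves as the reference measure: the linear terms of arbitrary
  integrable potentials are the same under every coupling, so the deficits in both problems are
  integrals of nonnegative tangent gaps. Every maximizer then turns out to be a shift of the bounded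
  one, and its properties are read off from it.\<close>

section \<open>Boltzmann weights, bounded potentials and Jensen's inequality\<close>

lemma exp_eq_tangent_iff: "exp t = 1 + t \<longleftrightarrow> t = 0" for t :: real
  using exp_minus_greater[of "-t"] by (cases "t = 0") auto

text \<open>This is \<open>exp (- t)\<close> as a real number, so that Bochner integrals apply. The
  case distinction is essential: \<open>enn2real\<close> sends infinity to 0, which would give
  weight 1 instead of 0.\<close>

definition boltz :: "ennreal \<Rightarrow> real" where
  "boltz t = (if t = \<infinity> then 0 else exp (- enn2real t))"

lemma boltz_measurable [measurable]: "boltz \<in> borel_measurable borel"
  unfolding boltz_def by measurable

lemma boltz_nonneg [simp]: "0 \<le> boltz t" and boltz_le_1 [simp]: "boltz t \<le> 1"
  by (auto simp: boltz_def)

lemma boltz_pos_iff: "0 < boltz t \<longleftrightarrow> t \<noteq> \<infinity>"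
  by (auto simp: boltz_def)

text \<open>The bound is required at every point of the space and not almost everywhere, so that
  transforms are finite and bounded at every point and no null sets have to be tracked.\<close>

definition bdd_meas :: "'a measure \<Rightarrow> real \<Rightarrow> ('a \<Rightarrow> real) \<Rightarrow> bool" where
  "bdd_meas M R f \<longleftrightarrow> f \<in> borel_measurable M \<and> (\<forall>x\<in>space M. \<bar>f x\<bar> \<le> R)"

lemma bdd_meas_measurable [measurable_dest]: "bdd_meas M R f \<Longrightarrow> f \<in> borel_measurable M"
  by (simp add: bdd_meas_def)

lemma bdd_meas_le: "bdd_meas M R f \<Longrightarrow> x \<in> space M \<Longrightarrow> \<bar>f x\<bar> \<le> R"
  by (simp add: bdd_meas_def)

lemma bdd_meas_mono: "bdd_meas M R f \<Longrightarrow> R \<le> S \<Longrightarrow> bdd_meas M S f"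
  by (force simp: bdd_meas_def)

lemma bdd_meas_zero: "0 \<le> R \<Longrightarrow> bdd_meas M R (\<lambda>_. 0)"
  by (simp add: bdd_meas_def)

lemma bdd_meas_shift: "bdd_meas M R f \<Longrightarrow> \<bar>t\<bar> \<le> S \<Longrightarrow> bdd_meas M (R + S) (\<lambda>x. f x + t)"
  unfolding bdd_meas_def by (auto intro: order_trans[OF abs_triangle_ineq] add_mono)

lemma bdd_meas_mid:
  assumes "bdd_meas M R f" "bdd_meas M S g"
  shows "bdd_meas M (max R S) (\<lambda>x. (f x + g x) / 2)"
  unfolding bdd_meas_def
proof safe
  show "(\<lambda>x. (f x + g x) / 2) \<in> borel_measurable M"
    using assms by measurable
  fix x assume "x \<in> space M"
  then have "\<bar>f x\<bar> \<le> R" "\<bar>g x\<bar> \<le> S" using assms by (auto simp: bdd_meas_def)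
  then show "\<bar>(f x + g x) / 2\<bar> \<le> max R S" by (auto simp: abs_if max_def field_simps split: if_splits)
qed

lemma (in finite_measure) bdd_meas_integrable: "bdd_meas M R f \<Longrightarrow> integrable M f"
  by (rule integrable_const_bound[of _ R]) (auto simp: bdd_meas_def)

lemma (in prob_space) bdd_meas_expectation:
  assumes "bdd_meas M R f" shows "\<bar>expectation f\<bar> \<le> R"
proof -
  have "\<bar>expectation f\<bar> \<le> expectation (\<lambda>x. \<bar>f x\<bar>)" by (rule integral_abs_bound)
  also have "\<dots> \<le> expectation (\<lambda>_. R)"
    using assms by (intro integral_mono) (auto simp: bdd_meas_def intro!: bdd_meas_integrable)
  finally show ?thesis by (simp add: prob_space)
qed

text \<open>Jensen's inequality, by way of the tangent of the exponential at the mean of \<open>a - c\<close>.\<close>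

lemma (in prob_space) boltz_expectation_ge:
  fixes c :: "'a \<Rightarrow> ennreal"
  assumes a: "bdd_meas M R a" and [measurable]: "c \<in> borel_measurable M"
    and le: "(\<integral>\<^sup>+ x. c x \<partial>M) \<le> ennreal K" and "0 \<le> K"
  shows "exp (expectation a - K) \<le> expectation (\<lambda>x. exp (a x) * boltz (c x))"
proof -
  note [measurable] = bdd_meas_measurable[OF a]
  define r where "r x = enn2real (c x)" for x
  have [measurable]: "r \<in> borel_measurable M" unfolding r_def by measurable
  have r_nonneg: "0 \<le> r x" for x by (simp add: r_def)
  have fin: "AE x in M. c x \<noteq> \<infinity>"
    using le by (intro nn_integral_PInf_AE) (auto simp: top_unique)
  have rc: "(\<integral>\<^sup>+ x. ennreal (r x) \<partial>M) = (\<integral>\<^sup>+ x. c x \<partial>M)"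
    by (rule nn_integral_cong_AE) (use fin in \<open>auto simp: r_def top.not_eq_extremum\<close>)
  have ir: "integrable M r"
    using le by (intro integrableI_nonneg) (auto simp: rc r_nonneg intro: le_less_trans)
  have er: "expectation r \<le> K"
  proof -
    have "ennreal (expectation r) \<le> ennreal K"
      using le nn_integral_eq_integral[OF ir] r_nonneg by (simp add: rc)
    then show ?thesis using \<open>0 \<le> K\<close> by (simp add: ennreal_le_iff)
  qed
  have ia: "integrable M a" using a by (rule bdd_meas_integrable)
  define m where "m = expectation (\<lambda>x. a x - r x)"
  have me: "m = expectation a - expectation r" unfolding m_def using ia ir by simp
  have ie: "integrable M (\<lambda>x. exp (a x) * boltz (c x))"
  proof (rule integrable_const_bound[of _ "exp R"])
    show "AE x in M. norm (exp (a x) * boltz (c x)) \<le> exp R"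
    proof (rule AE_I2)
      fix x assume "x \<in> space M"
      then have "exp (a x) \<le> exp R" using bdd_meas_le[OF a] by (auto simp: abs_le_iff)
      then show "norm (exp (a x) * boltz (c x)) \<le> exp R"
        using mult_mono[of "exp (a x)" "exp R" "boltz (c x)" 1] by (simp add: abs_mult)
    qed
  qed measurable
  have "exp m = expectation (\<lambda>x. exp m * (1 + ((a x - r x) - m)))"
    using ia ir by (simp add: prob_space me)
  also have "\<dots> \<le> expectation (\<lambda>x. exp (a x) * boltz (c x))"
  proof (rule integral_mono_AE)
    show "integrable M (\<lambda>x. exp m * (1 + ((a x - r x) - m)))" using ia ir by simp
    show "AE x in M. exp m * (1 + (a x - r x - m)) \<le> exp (a x) * boltz (c x)"
      using fin
    proof eventually_elim
      case (elim x)
      have "exp m * (1 + (a x - r x - m)) \<le> exp m * exp (a x - r x - m)"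
        by (intro mult_left_mono exp_ge_add_one_self) auto
      also have "\<dots> = exp (a x) * boltz (c x)"
        using elim by (simp add: boltz_def r_def exp_diff exp_minus divide_inverse)
      finally show ?case .
    qed
  qed (rule ie)
  finally have "exp m \<le> expectation (\<lambda>x. exp (a x) * boltz (c x))" .
  moreover have "exp (expectation a - K) \<le> exp m" using er by (simp add: me)
  ultimately show ?thesis by linarith
qed

section \<open>The normalised dual problem\<close>

definition partition_fun :: "'a measure \<Rightarrow> ('a \<times> 'b \<Rightarrow> ennreal) \<Rightarrow> ('a \<Rightarrow> real) \<Rightarrow> 'b \<Rightarrow> real" where
  "partition_fun M C a y = (\<integral>x. exp (a x) * boltz (C (x, y)) \<partial>M)"

text \<open>The dual functional divided by \<epsilon>, without its additive constant; this is the
  origin of the terms \<open>- 1\<close> below. The integrals are Bochner integrals, so the value is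
  meaningful for bounded potentials, where everything is integrable.\<close>

definition dual_real ::
    "'a measure \<Rightarrow> 'b measure \<Rightarrow> ('a \<times> 'b \<Rightarrow> ennreal) \<Rightarrow> ('a \<Rightarrow> real) \<Rightarrow> ('b \<Rightarrow> real) \<Rightarrow> real" where
  "dual_real M N C a b = (\<integral>x. a x \<partial>M) + (\<integral>y. b y \<partial>N)
     - (\<integral>z. exp (a (fst z) + b (snd z)) * boltz (C z) \<partial>(M \<Otimes>\<^sub>M N))"

text \<open>\<open>C\<close> stands for the cost divided by \<epsilon>, so \<epsilon> is 1 inside
  the locale, and measurability takes the place of topology. The assumptions are symmetric in the
  two factors; through \<open>swap\<close>, facts about one transform also serve for the
  other.\<close>

locale entropic_transport = M: prob_space M + N: prob_space N
  for M :: "'a measure" and N :: "'b measure" +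
  fixes C :: "'a \<times> 'b \<Rightarrow> ennreal" and K :: real
  assumes C_measurable [measurable]: "C \<in> borel_measurable (M \<Otimes>\<^sub>M N)"
    and K_nonneg: "0 \<le> K"
    and C_bound_fst: "\<And>y. y \<in> space N \<Longrightarrow> (\<integral>\<^sup>+ x. C (x, y) \<partial>M) \<le> ennreal K"
    and C_bound_snd: "\<And>x. x \<in> space M \<Longrightarrow> (\<integral>\<^sup>+ y. C (x, y) \<partial>N) \<le> ennreal K"

sublocale entropic_transport \<subseteq> P: pair_prob_space M N ..

context entropic_transport
begin

lemma swap: "entropic_transport N M (\<lambda>z. C (snd z, fst z)) K"
proof
  show "(\<lambda>z. C (snd z, fst z)) \<in> borel_measurable (N \<Otimes>\<^sub>M M)" by measurable
qed (use K_nonneg C_bound_fst C_bound_snd in auto)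

lemma dual_real_swap: "dual_real N M (\<lambda>z. C (snd z, fst z)) b a = dual_real M N C a b"
  if [measurable]: "a \<in> borel_measurable M" "b \<in> borel_measurable N"
proof -
  interpret Q: pair_sigma_finite N M ..
  have "(\<integral>z. exp (a (fst z) + b (snd z)) * boltz (C z) \<partial>(M \<Otimes>\<^sub>M N))
     = (\<integral>z. exp (b (fst z) + a (snd z)) * boltz (C (snd z, fst z)) \<partial>(N \<Otimes>\<^sub>M M))"
    by (subst P.distr_pair_swap, subst integral_distr)
       (auto simp: case_prod_beta add.commute intro!: Bochner_Integration.integral_cong)
  then show ?thesis by (simp add: dual_real_def add.commute)
qed

section \<open>Gibbs densities and partial maximization by the transform\<close>

definition gibbs :: "('a \<Rightarrow> real) \<Rightarrow> ('b \<Rightarrow> real) \<Rightarrow> 'a \<times> 'b \<Rightarrow> real" where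
  "gibbs a b z = exp (a (fst z) + b (snd z)) * boltz (C z)"

lemma gibbs_nonneg [simp]: "0 \<le> gibbs a b z"
  by (simp add: gibbs_def)

lemma gibbs_measurable [measurable]:
  assumes [measurable]: "a \<in> borel_measurable M" "b \<in> borel_measurable N"
  shows "gibbs a b \<in> borel_measurable (M \<Otimes>\<^sub>M N)"
  unfolding gibbs_def by measurable

lemma gibbs_le:
  assumes "bdd_meas M R a" "bdd_meas N S b" "z \<in> space (M \<Otimes>\<^sub>M N)"
  shows "gibbs a b z \<le> exp (R + S)"
proof -
  have "a (fst z) \<le> R" "b (snd z) \<le> S"
    using assms bdd_meas_le[OF assms(1), of "fst z"] bdd_meas_le[OF assms(2), of "snd z"]
    by (auto simp: space_pair_measure)
  then have "exp (a (fst z) + b (snd z)) * boltz (C z) \<le> exp (R + S) * 1"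
    by (intro mult_mono) auto
  then show ?thesis by (simp add: gibbs_def)
qed

lemma integrable_gibbs:
  assumes "bdd_meas M R a" "bdd_meas N S b"
  shows "integrable (M \<Otimes>\<^sub>M N) (gibbs a b)"
proof (rule P.P.integrable_const_bound[of _ "exp (R + S)"])
  show "AE z in M \<Otimes>\<^sub>M N. norm (gibbs a b z) \<le> exp (R + S)"
    by (rule AE_I2) (simp add: gibbs_le[OF assms])
qed (use assms in measurable)

lemma partition_fun_measurable [measurable]:
  assumes [measurable]: "a \<in> borel_measurable M"
  shows "partition_fun M C a \<in> borel_measurable N"
  unfolding partition_fun_def by measurable

lemma partition_fun_ge:
  assumes "bdd_meas M R a" "y \<in> space N"
  shows "exp ((\<integral>x. a x \<partial>M) - K) \<le> partition_fun M C a y"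
  unfolding partition_fun_def
  using assms by (intro M.boltz_expectation_ge C_bound_fst K_nonneg) measurable

lemma partition_fun_le:
  assumes a: "bdd_meas M R a" and m: "\<And>x. x \<in> space M \<Longrightarrow> a x \<le> m" and y [measurable]: "y \<in> space N"
  shows "partition_fun M C a y \<le> exp m"
proof -
  note [measurable] = bdd_meas_measurable[OF a]
  have le: "exp (a x) * boltz (C (x, y)) \<le> exp m" if "x \<in> space M" for x
    using mult_mono[of "exp (a x)" "exp m" "boltz (C (x, y))" 1] m[OF that] by simp
  have "partition_fun M C a y \<le> (\<integral>x. exp m \<partial>M)"
    unfolding partition_fun_def
  proof (rule integral_mono)
    show "integrable M (\<lambda>x. exp (a x) * boltz (C (x, y)))"
      by (rule M.integrable_const_bound[of _ "exp m"]) (auto intro!: AE_I2 simp: le)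
  qed (auto simp: le)
  then show ?thesis by (simp add: M.prob_space)
qed

definition ctrans :: "('a \<Rightarrow> real) \<Rightarrow> 'b \<Rightarrow> real" where
  "ctrans a y = - ln (partition_fun M C a y)"

lemma ctrans_measurable [measurable]: "a \<in> borel_measurable M \<Longrightarrow> ctrans a \<in> borel_measurable N"
  unfolding ctrans_def by measurable

lemma partition_fun_pos: "bdd_meas M R a \<Longrightarrow> y \<in> space N \<Longrightarrow> 0 < partition_fun M C a y"
  using partition_fun_ge[of R a y] by (smt (verit) exp_gt_zero)

lemma exp_ctrans: "bdd_meas M R a \<Longrightarrow> y \<in> space N \<Longrightarrow> exp (ctrans a y) * partition_fun M C a y = 1"
  using partition_fun_pos[of R a y] by (simp add: ctrans_def exp_minus)

text \<open>Jensen's inequality bounds the partition function from below through the mean of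
  \<open>a\<close> alone. The bound \<open>R\<close> does not enter, which makes a box independent
  of the initial pair possible.\<close>

lemma ctrans_le:
  assumes "bdd_meas M R a" "y \<in> space N"
  shows "ctrans a y \<le> K - (\<integral>x. a x \<partial>M)"
proof -
  have "(\<integral>x. a x \<partial>M) - K \<le> ln (partition_fun M C a y)"
    using partition_fun_ge[OF assms] partition_fun_pos[OF assms] by (simp add: ln_ge_iff)
  then show ?thesis by (simp add: ctrans_def)
qed

text \<open>The Boltzmann weight is at most 1, so the partition function is at most
  \<open>exp m\<close>. The upper bound \<open>m\<close> is kept apart from \<open>R\<close> because
  a potential may have a small upper bound while its two-sided bound is still large.\<close>

lemma ctrans_ge:
  assumes "bdd_meas M R a" "\<And>x. x \<in> space M \<Longrightarrow> a x \<le> m" "y \<in> space N"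
  shows "- m \<le> ctrans a y"
  using partition_fun_le[OF assms] partition_fun_pos[OF assms(1,3)]
  unfolding ctrans_def by (metis ln_exp ln_le_cancel_iff exp_gt_zero neg_le_iff_le)

lemma bdd_meas_ctrans:
  assumes "bdd_meas M R a" shows "bdd_meas N (K + R) (ctrans a)"
  unfolding bdd_meas_def
proof safe
  show "ctrans a \<in> borel_measurable N" using assms by measurable
  fix y assume y: "y \<in> space N"
  have "a x \<le> R" if "x \<in> space M" for x using bdd_meas_le[OF assms that] by simp
  then have "- R \<le> ctrans a y" using ctrans_ge[OF assms _ y] by blast
  moreover have "ctrans a y \<le> K + R"
    using ctrans_le[OF assms y] M.bdd_meas_expectation[OF assms] by simp
  ultimately show "\<bar>ctrans a y\<bar> \<le> K + R" using K_nonneg by simp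
qed

lemma integral_gibbs_partition:
  assumes "bdd_meas M R a" "bdd_meas N S b"
  shows "(\<integral>z. gibbs a b z \<partial>(M \<Otimes>\<^sub>M N)) = (\<integral>y. exp (b y) * partition_fun M C a y \<partial>N)"
proof -
  have i: "integrable (M \<Otimes>\<^sub>M N) (\<lambda>(x, y). gibbs a b (x, y))"
    using integrable_gibbs[OF assms] by (simp add: case_prod_beta)
  have "(\<integral>z. gibbs a b z \<partial>(M \<Otimes>\<^sub>M N)) = (\<integral>y. (\<integral>x. gibbs a b (x, y) \<partial>M) \<partial>N)"
    using P.integral_snd[OF i] by (simp add: case_prod_beta)
  also have "\<dots> = (\<integral>y. exp (b y) * partition_fun M C a y \<partial>N)"
    by (simp add: gibbs_def partition_fun_def exp_add mult_ac flip: integral_mult_right_zero)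
  finally show ?thesis .
qed

lemma dual_real_gibbs:
  "dual_real M N C a b = (\<integral>x. a x \<partial>M) + (\<integral>y. b y \<partial>N) - (\<integral>z. gibbs a b z \<partial>(M \<Otimes>\<^sub>M N))"
  by (simp add: dual_real_def gibbs_def[abs_def])

lemma integrable_exp_partition:
  assumes "bdd_meas M R a" "bdd_meas N S b"
  shows "integrable N (\<lambda>y. exp (b y) * partition_fun M C a y)"
proof -
  have i: "integrable (M \<Otimes>\<^sub>M N) (\<lambda>(x, y). gibbs a b (x, y))"
    using integrable_gibbs[OF assms] by (simp add: case_prod_beta)
  from P.integrable_snd[OF i] show ?thesis
    by (simp add: gibbs_def partition_fun_def exp_add mult_ac flip: integral_mult_right_zero)
qed

text \<open>Since \<open>exp (ctrans a y)\<close> times the partition function is 1, the Gibbs mass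
  becomes the integral of \<open>exp s\<close> with \<open>s = b - ctrans a\<close>. The gap
  integrand \<open>exp s - (1 + s)\<close> is nonnegative, so the transform is a best response to
  \<open>a\<close>, and it vanishes only at \<open>s = 0\<close>, so the best response is unique
  almost everywhere.\<close>

lemma dual_real_ctrans_gap:
  assumes a: "bdd_meas M R a" and b: "bdd_meas N S b"
  shows "dual_real M N C a (ctrans a) - dual_real M N C a b
     = (\<integral>y. exp (b y - ctrans a y) - (1 + (b y - ctrans a y)) \<partial>N)"
    and "integrable N (\<lambda>y. exp (b y - ctrans a y) - (1 + (b y - ctrans a y)))"
proof -
  note t = bdd_meas_ctrans[OF a]
  have e: "exp (f y) * partition_fun M C a y = exp (f y - ctrans a y)" if "y \<in> space N" for y f
    using exp_ctrans[OF a that] by (simp add: exp_diff field_simps)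
  have i: "integrable N (\<lambda>y. exp (b y - ctrans a y))"
    using integrable_exp_partition[OF a b] by (subst Bochner_Integration.integrable_cong[OF refl e[symmetric]]) auto
  have ib: "integrable N b" and it: "integrable N (ctrans a)"
    using b t by (auto intro: N.bdd_meas_integrable)
  have 1: "dual_real M N C a b = (\<integral>x. a x \<partial>M) + (\<integral>y. b y \<partial>N) - (\<integral>y. exp (b y - ctrans a y) \<partial>N)"
    unfolding dual_real_gibbs integral_gibbs_partition[OF a b]
    by (simp add: e cong: Bochner_Integration.integral_cong)
  have 2: "dual_real M N C a (ctrans a) = (\<integral>x. a x \<partial>M) + (\<integral>y. ctrans a y \<partial>N) - 1"
    unfolding dual_real_gibbs integral_gibbs_partition[OF a t]
    by (simp add: e N.prob_space cong: Bochner_Integration.integral_cong)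
  show "dual_real M N C a (ctrans a) - dual_real M N C a b
     = (\<integral>y. exp (b y - ctrans a y) - (1 + (b y - ctrans a y)) \<partial>N)"
    using i ib it by (simp add: 1 2 N.prob_space)
  show "integrable N (\<lambda>y. exp (b y - ctrans a y) - (1 + (b y - ctrans a y)))"
    using i ib it by simp
qed

lemma dual_real_ctrans:
  assumes a: "bdd_meas M R a"
  shows "dual_real M N C a (ctrans a) = (\<integral>x. a x \<partial>M) + (\<integral>y. ctrans a y \<partial>N) - 1"
  unfolding dual_real_gibbs integral_gibbs_partition[OF a bdd_meas_ctrans[OF a]]
  by (simp add: exp_ctrans[OF a] N.prob_space cong: Bochner_Integration.integral_cong)

lemma dual_real_ctrans_ge:
  assumes "bdd_meas M R a" "bdd_meas N S b"
  shows "dual_real M N C a b \<le> dual_real M N C a (ctrans a)"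
proof -
  have "0 \<le> (\<integral>y. exp (b y - ctrans a y) - (1 + (b y - ctrans a y)) \<partial>N)"
    by (rule integral_nonneg_AE) (use exp_ge_add_one_self in \<open>auto intro!: AE_I2\<close>)
  then show ?thesis using dual_real_ctrans_gap(1)[OF assms] by linarith
qed

lemma ctrans_eq_of_dual_real_ge:
  assumes "bdd_meas M R a" "bdd_meas N S b"
    and "dual_real M N C a (ctrans a) \<le> dual_real M N C a b"
  shows "AE y in N. b y = ctrans a y"
proof -
  let ?f = "\<lambda>y. exp (b y - ctrans a y) - (1 + (b y - ctrans a y))"
  have nn: "0 \<le> ?f y" for y using exp_ge_add_one_self[of "b y - ctrans a y"] by simp
  have "(\<integral>y. ?f y \<partial>N) = 0"
    using dual_real_ctrans_gap(1)[OF assms(1,2)] dual_real_ctrans_ge[OF assms(1,2)] assms(3) by simp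
  then have "AE y in N. ?f y = 0"
    using integral_nonneg_eq_0_iff_AE[OF dual_real_ctrans_gap(2)[OF assms(1,2)]] nn by simp
  then show ?thesis
  proof eventually_elim
    case (elim y)
    then have "exp (b y - ctrans a y) = 1 + (b y - ctrans a y)" by linarith
    then show ?case using exp_eq_tangent_iff by auto
  qed
qed

section \<open>Reduction to a fixed box of potentials\<close>

lemma gibbs_shift: "gibbs (\<lambda>x. a x + t) (\<lambda>y. b y - t) = gibbs a b"
  by (auto simp: gibbs_def)

lemma dual_real_shift:
  assumes "integrable M a" "integrable N b"
  shows "dual_real M N C (\<lambda>x. a x + t) (\<lambda>y. b y - t) = dual_real M N C a b"
  using assms by (simp add: dual_real_gibbs gibbs_shift M.prob_space N.prob_space)

text \<open>The box is reached by three alternating transforms, started from a potential of mean zero.\<close>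

lemma dual_real_improve:
  assumes a: "bdd_meas M R a" and b: "bdd_meas N S b" and ge: "- 1 \<le> dual_real M N C a b"
  obtains a' b' where "bdd_meas M (2 * K) a'" "bdd_meas N (2 * K) b'"
    "dual_real M N C a b \<le> dual_real M N C a' b'"
proof -
  interpret S: entropic_transport N M "\<lambda>z. C (snd z, fst z)" K by (rule swap)
  note [measurable] = bdd_meas_measurable[OF a] bdd_meas_measurable[OF b]
  \<comment> \<open>With the mean of the first potential shifted to 0, the upper bound of
    \<open>ctrans_le\<close> is just \<open>K\<close>.\<close>
  define t where "t = (\<integral>x. a x \<partial>M)"
  define a1 where "a1 = (\<lambda>x. a x + - t)"
  define b1 where "b1 = (\<lambda>y. b y - - t)"
  have ia: "integrable M a" and ib: "integrable N b"
    using a b by (auto intro: M.bdd_meas_integrable N.bdd_meas_integrable)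
  have a1: "bdd_meas M (R + \<bar>t\<bar>) a1" unfolding a1_def by (rule bdd_meas_shift[OF a]) simp
  have b1: "bdd_meas N (S + \<bar>t\<bar>) b1" unfolding b1_def using bdd_meas_shift[OF b, of t] by simp
  have J1: "dual_real M N C a1 b1 = dual_real M N C a b"
    unfolding a1_def b1_def by (rule dual_real_shift[OF ia ib])
  have int1: "(\<integral>x. a1 x \<partial>M) = 0" using ia by (simp add: a1_def t_def M.prob_space)
  define b2 where "b2 = ctrans a1"
  have b2: "bdd_meas N (K + (R + \<bar>t\<bar>)) b2" unfolding b2_def by (rule bdd_meas_ctrans[OF a1])
  have J2: "dual_real M N C a b \<le> dual_real M N C a1 b2"
    using dual_real_ctrans_ge[OF a1 b1] by (simp add: J1 b2_def)
  have b2_le: "b2 y \<le> K" if "y \<in> space N" for y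
    using ctrans_le[OF a1 that] by (simp add: b2_def int1)
  \<comment> \<open>The value at \<open>(a1, b2)\<close> is the mean of \<open>b2\<close> minus 1,
    and it is at least \<open>- 1\<close> by assumption.\<close>
  have int2: "0 \<le> (\<integral>y. b2 y \<partial>N)"
    using dual_real_ctrans[OF a1] J2 ge by (simp add: b2_def int1)
  have int2': "(\<integral>y. b2 y \<partial>N) \<le> K"
    using N.integral_le_const[of b2 K] b2_le b2 N.bdd_meas_integrable by (auto intro: AE_I2)
  define a3 where "a3 = S.ctrans b2"
  \<comment> \<open>The upper bound comes from the nonnegative mean of \<open>b2\<close>, the lower
    one from \<open>b2 \<le> K\<close>; the initial bounds \<open>R\<close> and \<open>S\<close>
    have disappeared.\<close>
  have a3: "bdd_meas M K a3"
    unfolding bdd_meas_def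
  proof safe
    show "a3 \<in> borel_measurable M" unfolding a3_def using bdd_meas_measurable[OF b2] by measurable
    fix x assume x: "x \<in> space M"
    show "\<bar>a3 x\<bar> \<le> K"
      using S.ctrans_le[OF b2 x] S.ctrans_ge[OF b2 b2_le x] int2 by (simp add: a3_def)
  qed
  note [measurable] = a1[THEN bdd_meas_measurable] b2[THEN bdd_meas_measurable] a3[THEN bdd_meas_measurable]
  have J3: "dual_real M N C a1 b2 \<le> dual_real M N C a3 b2"
    using S.dual_real_ctrans_ge[OF b2 a1] by (simp add: dual_real_swap flip: a3_def)
  have "dual_real M N C a3 b2 = (\<integral>y. b2 y \<partial>N) + (\<integral>x. a3 x \<partial>M) - 1"
    using S.dual_real_ctrans[OF b2] by (simp add: dual_real_swap flip: a3_def)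
  then have int3: "- K \<le> (\<integral>x. a3 x \<partial>M)" using J2 J3 ge int2' by linarith
  \<comment> \<open>The origin of \<open>2 * K\<close>: a transform is bounded by \<open>K\<close>
    plus the bound of its argument, here again \<open>K\<close>.\<close>
  define b4 where "b4 = ctrans a3"
  have b4: "bdd_meas N (2 * K) b4"
    using bdd_meas_ctrans[OF a3] by (simp add: b4_def)
  have J4: "dual_real M N C a3 b2 \<le> dual_real M N C a3 b4"
    unfolding b4_def by (rule dual_real_ctrans_ge[OF a3 b2])
  show ?thesis
    using J2 J3 J4 K_nonneg bdd_meas_mono[OF a3, of "2 * K"] b4 that[of a3 b4] by linarith
qed

lemma dual_real_le:
  assumes "bdd_meas M R a" "bdd_meas N S b"
  shows "dual_real M N C a b \<le> R + S"
  using M.bdd_meas_expectation[OF assms(1)] N.bdd_meas_expectation[OF assms(2)]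
    Bochner_Integration.integral_nonneg[of "M \<Otimes>\<^sub>M N" "gibbs a b", OF gibbs_nonneg]
  unfolding dual_real_gibbs by linarith

text \<open>For zero potentials the Gibbs mass is at most 1. This explains the threshold
  \<open>- 1\<close> in \<open>dual_real_improve\<close>: a pair below it is already beaten by the
  zero pair, which lies in the box.\<close>

lemma dual_real_0_ge: "- 1 \<le> dual_real M N C (\<lambda>_. 0) (\<lambda>_. 0)"
proof -
  have 0: "bdd_meas M 0 (\<lambda>_. 0)" "bdd_meas N 0 (\<lambda>_. 0)" by (simp_all add: bdd_meas_zero)
  have "(\<integral>z. gibbs (\<lambda>_. 0) (\<lambda>_. 0) z \<partial>(M \<Otimes>\<^sub>M N)) \<le> 1"
    using gibbs_le[OF 0] integrable_gibbs[OF 0] by (intro P.P.integral_le_const) (auto intro: AE_I2)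
  then show ?thesis by (simp add: dual_real_gibbs)
qed

text \<open>The supremum is over the box only, so that maximizing sequences come with uniform
  bounds. It nevertheless bounds the value of every bounded pair, which matters when a transform of
  a maximizer is compared with it.\<close>

definition dual_sup :: real where
  "dual_sup = (SUP p\<in>{p. bdd_meas M (2 * K) (fst p) \<and> bdd_meas N (2 * K) (snd p)}.
     dual_real M N C (fst p) (snd p))"

lemma dual_box_bdd_above:
  "bdd_above ((\<lambda>p. dual_real M N C (fst p) (snd p)) `
     {p. bdd_meas M (2 * K) (fst p) \<and> bdd_meas N (2 * K) (snd p)})"
  by (rule bdd_aboveI[of _ "2 * K + 2 * K"]) (use dual_real_le in fastforce)

lemma dual_real_le_sup:
  assumes "bdd_meas M R a" "bdd_meas N S b"
  shows "dual_real M N C a b \<le> dual_sup"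
proof -
  have box: "dual_real M N C a' b' \<le> dual_sup" if "bdd_meas M (2 * K) a'" "bdd_meas N (2 * K) b'" for a' b'
    unfolding dual_sup_def using that cSUP_upper[OF _ dual_box_bdd_above, of "(a', b')"] by simp
  show ?thesis
  proof (cases "- 1 \<le> dual_real M N C a b")
    case True
    from dual_real_improve[OF assms True] obtain a' b' where
      "bdd_meas M (2 * K) a'" "bdd_meas N (2 * K) b'" "dual_real M N C a b \<le> dual_real M N C a' b'" .
    then show ?thesis using box by force
  next
    case False
    then have "dual_real M N C a b \<le> dual_real M N C (\<lambda>_. 0) (\<lambda>_. 0)" using dual_real_0_ge by simp
    also have "\<dots> \<le> dual_sup" by (rule box) (simp_all add: bdd_meas_zero K_nonneg)
    finally show ?thesis .
  qed
qed

lemma maximizing_sequence: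
  obtains a b where "\<And>n. bdd_meas M (2 * K) (a n)" "\<And>n. bdd_meas N (2 * K) (b n)"
    "\<And>n. dual_sup - 1 / real (Suc n) < dual_real M N C (a n) (b n)"
proof -
  let ?B = "{p. bdd_meas M (2 * K) (fst p) \<and> bdd_meas N (2 * K) (snd p)}"
  have "((\<lambda>_. 0), (\<lambda>_. 0)) \<in> ?B" by (simp add: bdd_meas_zero K_nonneg)
  then have ne: "?B \<noteq> {}" by blast
  have "\<exists>p\<in>?B. dual_sup - 1 / real (Suc n) < dual_real M N C (fst p) (snd p)" for n
    unfolding dual_sup_def
    using less_cSUP_iff[OF ne dual_box_bdd_above, of "dual_sup - 1 / real (Suc n)"]
    by (simp add: dual_sup_def)
  then have "\<forall>n. \<exists>p. p \<in> ?B \<and> dual_sup - 1 / real (Suc n) < dual_real M N C (fst p) (snd p)"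
    by blast
  from choice[OF this] obtain p where
    "\<And>n. p n \<in> ?B" "\<And>n. dual_sup - 1 / real (Suc n) < dual_real M N C (fst (p n)) (snd (p n))"
    by blast
  then show ?thesis using that[of "\<lambda>n. fst (p n)" "\<lambda>n. snd (p n)"] by simp
qed

section \<open>Strong concavity\<close>

text \<open>On the half-line from \<open>- R\<close> upwards the derivative of \<open>exp\<close> is
  at least \<open>exp (- R)\<close>. This reverse Lipschitz bound turns closeness of exponentials
  into closeness of exponents.\<close>

lemma exp_diff_ge:
  fixes s t R :: real
  assumes "- R \<le> s" "- R \<le> t"
  shows "exp (- R) * \<bar>s - t\<bar> \<le> \<bar>exp s - exp t\<bar>"
proof -
  have *: "exp (- R) * (s - t) \<le> exp s - exp t" if "t \<le> s" "- R \<le> t" for s t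
  proof -
    have "exp (- R) * (s - t) \<le> exp t * (exp (s - t) - 1)"
    proof (rule mult_mono)
      show "s - t \<le> exp (s - t) - 1" using exp_ge_add_one_self[of "s - t"] by linarith
    qed (use that in auto)
    moreover have "exp t * exp (s - t) = exp s"
      unfolding exp_add[symmetric] by (rule arg_cong[where f = exp]) linarith
    ultimately show ?thesis unfolding right_diff_distrib by linarith
  qed
  show ?thesis
  proof (cases "t \<le> s")
    case True
    then show ?thesis using *[OF True assms(2)] by (simp only: abs_of_nonneg diff_ge_0_iff_ge exp_le_cancel_iff)
  next
    case False
    then have "s \<le> t" by simp
    then show ?thesis using *[OF \<open>s \<le> t\<close> assms(1)]
      by (simp only: abs_minus_commute[of s t] abs_minus_commute[of "exp s" "exp t"] abs_of_nonneg diff_ge_0_iff_ge exp_le_cancel_iff)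
  qed
qed

text \<open>Strong concavity of the dual functional: the midpoint of two nearly optimal pairs beats
  both of them unless their Gibbs densities are close.\<close>

lemma dual_real_midpoint:
  assumes a: "bdd_meas M R a" "bdd_meas M R a'" and b: "bdd_meas N R b" "bdd_meas N R b'"
  shows "exp (- 2 * R) / 4 * (\<integral>z. ((a (fst z) + b (snd z)) - (a' (fst z) + b' (snd z)))\<^sup>2 * boltz (C z) \<partial>(M \<Otimes>\<^sub>M N))
     \<le> 2 * dual_sup - dual_real M N C a b - dual_real M N C a' b'"
proof -
  note [measurable] = a[THEN bdd_meas_measurable] b[THEN bdd_meas_measurable]
  let ?am = "\<lambda>x. (a x + a' x) / 2" and ?bm = "\<lambda>y. (b y + b' y) / 2"
  let ?w = "\<lambda>z. a (fst z) + b (snd z)" and ?w' = "\<lambda>z. a' (fst z) + b' (snd z)"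
  have am: "bdd_meas M R ?am" using bdd_meas_mid[OF a] by simp
  have bm: "bdd_meas N R ?bm" using bdd_meas_mid[OF b] by simp
  have ints: "integrable M a" "integrable M a'" "integrable N b" "integrable N b'"
    using a b by (auto intro: M.bdd_meas_integrable N.bdd_meas_integrable)
  have ig: "integrable (M \<Otimes>\<^sub>M N) (gibbs a b)" "integrable (M \<Otimes>\<^sub>M N) (gibbs a' b')"
    "integrable (M \<Otimes>\<^sub>M N) (gibbs ?am ?bm)"
    using a b am bm by (auto intro: integrable_gibbs)
  \<comment> \<open>The Gibbs density of the midpoint is the geometric mean of the two densities, so
    the right-hand side is the squared difference of their square roots. The half sums are at least
    \<open>- R\<close>; squaring the factors \<open>exp (- R)\<close> and \<open>1 / 2\<close> gives
    the constant \<open>exp (- 2 * R) / 4\<close>.\<close>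
  have pt: "exp (- 2 * R) / 4 * ((?w z - ?w' z)\<^sup>2 * boltz (C z))
      \<le> gibbs a b z + gibbs a' b' z - 2 * gibbs ?am ?bm z" if z: "z \<in> space (M \<Otimes>\<^sub>M N)" for z
  proof -
    have "\<bar>a (fst z)\<bar> \<le> R" "\<bar>a' (fst z)\<bar> \<le> R" "\<bar>b (snd z)\<bar> \<le> R" "\<bar>b' (snd z)\<bar> \<le> R"
      using z a b by (auto simp: bdd_meas_def space_pair_measure)
    then have "- R \<le> ?w z / 2" "- R \<le> ?w' z / 2" by (auto simp: abs_le_iff)
    then have "(exp (- R) * \<bar>?w z / 2 - ?w' z / 2\<bar>)\<^sup>2 \<le> \<bar>exp (?w z / 2) - exp (?w' z / 2)\<bar>\<^sup>2"
      by (intro power_mono exp_diff_ge) auto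
    moreover have "(exp (- R) * \<bar>?w z / 2 - ?w' z / 2\<bar>)\<^sup>2 = exp (- 2 * R) / 4 * (?w z - ?w' z)\<^sup>2"
    proof -
      have "(exp (- R))\<^sup>2 = exp (- 2 * R)" using exp_double[of "- R"] by simp
      moreover have "\<bar>?w z / 2 - ?w' z / 2\<bar>\<^sup>2 = (?w z - ?w' z)\<^sup>2 / 4"
        unfolding power2_abs by (simp add: power2_eq_square field_simps)
      ultimately show ?thesis unfolding power_mult_distrib by simp
    qed
    moreover have "\<bar>exp (?w z / 2) - exp (?w' z / 2)\<bar>\<^sup>2
        = exp (?w z) + exp (?w' z) - 2 * exp ((?w z + ?w' z) / 2)"
      using exp_double[of "?w z / 2"] exp_double[of "?w' z / 2"] exp_add[of "?w z / 2" "?w' z / 2"]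
      by (simp add: power2_diff add_divide_distrib)
    ultimately have "exp (- 2 * R) / 4 * (?w z - ?w' z)\<^sup>2 * boltz (C z)
        \<le> (exp (?w z) + exp (?w' z) - 2 * exp ((?w z + ?w' z) / 2)) * boltz (C z)"
      by (intro mult_right_mono) auto
    also have "\<dots> = gibbs a b z + gibbs a' b' z - 2 * gibbs ?am ?bm z"
    proof -
      have "(?w z + ?w' z) / 2 = ?am (fst z) + ?bm (snd z)" by (simp add: field_simps)
      then show ?thesis by (simp add: gibbs_def algebra_simps)
    qed
    finally show ?thesis by (simp add: mult.assoc)
  qed
  have "exp (- 2 * R) / 4 * (\<integral>z. (?w z - ?w' z)\<^sup>2 * boltz (C z) \<partial>(M \<Otimes>\<^sub>M N))
      = (\<integral>z. exp (- 2 * R) / 4 * ((?w z - ?w' z)\<^sup>2 * boltz (C z)) \<partial>(M \<Otimes>\<^sub>M N))"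
    by simp
  also have "\<dots> \<le> (\<integral>z. gibbs a b z + gibbs a' b' z - 2 * gibbs ?am ?bm z \<partial>(M \<Otimes>\<^sub>M N))"
  proof (rule integral_mono_AE)
    show "integrable (M \<Otimes>\<^sub>M N) (\<lambda>z. exp (- 2 * R) / 4 * ((?w z - ?w' z)\<^sup>2 * boltz (C z)))"
    proof (rule Bochner_Integration.integrable_bound)
      show "integrable (M \<Otimes>\<^sub>M N) (\<lambda>z. gibbs a b z + gibbs a' b' z - 2 * gibbs ?am ?bm z)"
        using ig by simp
      show "AE z in M \<Otimes>\<^sub>M N. norm (exp (- 2 * R) / 4 * ((?w z - ?w' z)\<^sup>2 * boltz (C z)))
         \<le> norm (gibbs a b z + gibbs a' b' z - 2 * gibbs ?am ?bm z)"
      proof (rule AE_I2)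
        fix z assume "z \<in> space (M \<Otimes>\<^sub>M N)"
        moreover have "0 \<le> exp (- 2 * R) / 4 * ((?w z - ?w' z)\<^sup>2 * boltz (C z))" by simp
        ultimately show "norm (exp (- 2 * R) / 4 * ((?w z - ?w' z)\<^sup>2 * boltz (C z)))
         \<le> norm (gibbs a b z + gibbs a' b' z - 2 * gibbs ?am ?bm z)"
          using pt[of z] unfolding real_norm_def by linarith
      qed
    qed measurable
  qed (use ig pt in auto)
  \<comment> \<open>The linear terms at the midpoint are the averages of those at the two pairs, so
    only the Gibbs masses survive in this second difference.\<close>
  also have "\<dots> = 2 * dual_real M N C ?am ?bm - dual_real M N C a b - dual_real M N C a' b'"
    using ig ints by (simp add: dual_real_gibbs add_divide_distrib algebra_simps)
  also have "\<dots> \<le> 2 * dual_sup - dual_real M N C a b - dual_real M N C a' b'"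
    using dual_real_le_sup[OF am bm] by simp
  finally show ?thesis by simp
qed

end

section \<open>Existence of a bounded maximizer\<close>

lemma (in prob_space) AE_imp_ex: "AE x in M. Q x \<Longrightarrow> \<exists>x\<in>space M. Q x"
proof (rule ccontr)
  assume ae: "AE x in M. Q x" and "\<not> (\<exists>x\<in>space M. Q x)"
  then have "AE x in M. \<not> Q x" by (intro AE_I2) auto
  with ae have "AE x in M. False" by eventually_elim simp
  then show False by simp
qed

context entropic_transport
begin

lemma C_nn_integral_le: "(\<integral>\<^sup>+ z. C z \<partial>(M \<Otimes>\<^sub>M N)) \<le> ennreal K"
proof -
  have "(\<integral>\<^sup>+ z. C z \<partial>(M \<Otimes>\<^sub>M N)) = (\<integral>\<^sup>+ x. \<integral>\<^sup>+ y. C (x, y) \<partial>N \<partial>M)"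
    by (simp add: N.nn_integral_fst)
  also have "\<dots> \<le> (\<integral>\<^sup>+ x. ennreal K \<partial>M)"
    by (intro nn_integral_mono C_bound_snd)
  finally show ?thesis by (simp add: M.emeasure_space_1)
qed

text \<open>Equivalently, the Boltzmann weight is positive almost everywhere. This permits division
  by the weight once the weighted sums converge, and later makes null sets of the plan null for the
  product measure.\<close>

lemma C_finite_AE: "AE z in M \<Otimes>\<^sub>M N. C z \<noteq> \<infinity>"
  using C_nn_integral_le by (intro nn_integral_PInf_AE) (auto simp: top_unique)

lemma distr_pair_snd: "distr (M \<Otimes>\<^sub>M N) N snd = N"
proof -
  have "distr (M \<Otimes>\<^sub>M N) N snd = distr (N \<Otimes>\<^sub>M M) N (snd \<circ> (\<lambda>(x, y). (y, x)))"
    by (subst P.distr_pair_swap, subst distr_distr) measurable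
  also have "snd \<circ> (\<lambda>(x, y). (y, x)) = (fst :: 'b \<times> 'a \<Rightarrow> 'b)" by auto
  finally show ?thesis by (simp add: M.distr_pair_fst)
qed

lemma AE_pair_fst: "AE x in M. Q x \<Longrightarrow> AE z in M \<Otimes>\<^sub>M N. Q (fst z)"
  by (rule AE_distrD[of fst "M \<Otimes>\<^sub>M N" M]) (simp, unfold N.distr_pair_fst)

lemma AE_pair_snd: "AE y in N. Q y \<Longrightarrow> AE z in M \<Otimes>\<^sub>M N. Q (snd z)"
  by (rule AE_distrD[of snd "M \<Otimes>\<^sub>M N" N]) (simp, unfold distr_pair_snd)

text \<open>The midpoint estimate bounds the weighted square of the difference \<open>D\<close> of
  two sums by the two deficits, which are below \<open>1 / Suc i\<close> and
  \<open>1 / Suc j\<close>.\<close>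

lemma maximizing_sequence_L1_Cauchy:
  assumes a: "\<And>n. bdd_meas M R (a n)" and b: "\<And>n. bdd_meas N R (b n)"
    and J: "\<And>n. dual_sup - 1 / real (Suc n) < dual_real M N C (a n) (b n)"
    and "0 < e"
  shows "\<exists>n0. \<forall>i\<ge>n0. \<forall>j\<ge>n0. (\<integral>z. norm ((a i (fst z) + b i (snd z)) * boltz (C z)
            - (a j (fst z) + b j (snd z)) * boltz (C z)) \<partial>(M \<Otimes>\<^sub>M N)) < e"
proof -
  note [measurable] = a[THEN bdd_meas_measurable] b[THEN bdd_meas_measurable]
  define q where "q = exp (- 2 * R) / 4"
  have q: "0 < q" by (simp add: q_def)
  \<comment> \<open>Chosen so that the deficits, at most \<open>2 / Suc n0\<close> together, are
    below \<open>q * e\<^sup>2\<close>; the weighted integral of \<open>D\<close> squared is then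
    below \<open>e\<^sup>2\<close>.\<close>
  obtain n0 where n0: "2 / (q * e\<^sup>2) < real n0" using reals_Archimedean2 by blast
  let ?w = "\<lambda>i z. a i (fst z) + b i (snd z)"
  have w_le: "\<bar>?w i z\<bar> \<le> 2 * R" if "z \<in> space (M \<Otimes>\<^sub>M N)" for i z
  proof -
    have "\<bar>a i (fst z)\<bar> \<le> R" "\<bar>b i (snd z)\<bar> \<le> R"
      using that a[of i] b[of i] by (auto simp: bdd_meas_def space_pair_measure)
    then show ?thesis by linarith
  qed
  have dw_le: "\<bar>?w i z - ?w j z\<bar> \<le> 4 * R" if "z \<in> space (M \<Otimes>\<^sub>M N)" for i j z
    using w_le[OF that, of i] w_le[OF that, of j] by linarith
  show ?thesis
  proof (intro exI allI impI)
    fix i j assume ij: "n0 \<le> i" "n0 \<le> j"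
    define D where "D = (\<lambda>z. ?w i z - ?w j z)"
    have [measurable]: "D \<in> borel_measurable (M \<Otimes>\<^sub>M N)" unfolding D_def by measurable
    have i2: "integrable (M \<Otimes>\<^sub>M N) (\<lambda>z. (D z)\<^sup>2 * boltz (C z))"
    proof (rule P.P.integrable_const_bound[of _ "(4 * R)\<^sup>2"])
      show "AE z in M \<Otimes>\<^sub>M N. norm ((D z)\<^sup>2 * boltz (C z)) \<le> (4 * R)\<^sup>2"
      proof (rule AE_I2)
        fix z assume z: "z \<in> space (M \<Otimes>\<^sub>M N)"
        have "\<bar>D z\<bar>\<^sup>2 \<le> (4 * R)\<^sup>2" unfolding D_def by (intro power_mono dw_le z) simp
        then have "(D z)\<^sup>2 * boltz (C z) \<le> (4 * R)\<^sup>2 * 1" by (intro mult_mono) auto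
        then show "norm ((D z)\<^sup>2 * boltz (C z)) \<le> (4 * R)\<^sup>2" by (simp add: abs_mult)
      qed
    qed measurable
    have "(\<integral>z. norm (?w i z * boltz (C z) - ?w j z * boltz (C z)) \<partial>(M \<Otimes>\<^sub>M N))
        \<le> (\<integral>z. e / 2 + (D z)\<^sup>2 * boltz (C z) / (2 * e) \<partial>(M \<Otimes>\<^sub>M N))"
    proof (rule integral_mono_AE')
      show "integrable (M \<Otimes>\<^sub>M N) (\<lambda>z. e / 2 + (D z)\<^sup>2 * boltz (C z) / (2 * e))"
        using i2 by simp
      \<comment> \<open>Young's inequality with parameter \<open>e\<close> passes from squares to
        absolute values; the weight is dropped from the constant term as it is at most 1. The two
        terms then contribute at most \<open>e / 2\<close> and less than
        \<open>e / 2\<close>.\<close>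
      have am: "norm (?w i z * boltz (C z) - ?w j z * boltz (C z)) \<le> e / 2 + (D z)\<^sup>2 * boltz (C z) / (2 * e)" for z
      proof -
        have "0 \<le> (\<bar>D z\<bar> - e)\<^sup>2" by simp
        then have "2 * e * \<bar>D z\<bar> \<le> e\<^sup>2 + (D z)\<^sup>2" by (simp add: power2_diff mult_ac add.commute)
        then have "\<bar>D z\<bar> \<le> (e\<^sup>2 + (D z)\<^sup>2) / (2 * e)" using \<open>0 < e\<close> by (simp add: field_simps)
        also have "\<dots> = e / 2 + (D z)\<^sup>2 / (2 * e)"
          using \<open>0 < e\<close> by (simp add: field_simps power2_eq_square)
        finally have "\<bar>D z\<bar> * boltz (C z) \<le> (e / 2 + (D z)\<^sup>2 / (2 * e)) * boltz (C z)"
          by (intro mult_right_mono) auto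
        also have "\<dots> = e / 2 * boltz (C z) + (D z)\<^sup>2 * boltz (C z) / (2 * e)"
          by (simp add: distrib_right)
        also have "e / 2 * boltz (C z) \<le> e / 2 * 1"
          using \<open>0 < e\<close> by (intro mult_left_mono) auto
        finally have "\<bar>D z\<bar> * boltz (C z) \<le> e / 2 + (D z)\<^sup>2 * boltz (C z) / (2 * e)" by simp
        moreover have "norm (?w i z * boltz (C z) - ?w j z * boltz (C z)) = \<bar>D z\<bar> * boltz (C z)"
          unfolding left_diff_distrib[symmetric] by (simp add: abs_mult D_def)
        ultimately show ?thesis by simp
      qed
      then show "AE z in M \<Otimes>\<^sub>M N. norm (?w i z * boltz (C z) - ?w j z * boltz (C z))
          \<le> e / 2 + (D z)\<^sup>2 * boltz (C z) / (2 * e)" by simp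
      show "AE z in M \<Otimes>\<^sub>M N. 0 \<le> e / 2 + (D z)\<^sup>2 * boltz (C z) / (2 * e)"
        using \<open>0 < e\<close> by simp
    qed
    also have "\<dots> = e / 2 + (\<integral>z. (D z)\<^sup>2 * boltz (C z) \<partial>(M \<Otimes>\<^sub>M N)) / (2 * e)"
      using i2 by (simp add: P.P.prob_space)
    also have "\<dots> < e / 2 + e / 2"
    proof -
      have "q * (\<integral>z. (D z)\<^sup>2 * boltz (C z) \<partial>(M \<Otimes>\<^sub>M N))
          \<le> 2 * dual_sup - dual_real M N C (a i) (b i) - dual_real M N C (a j) (b j)"
        unfolding D_def q_def by (rule dual_real_midpoint[OF a a b b])
      also have "\<dots> < 1 / real (Suc i) + 1 / real (Suc j)" using J[of i] J[of j] by linarith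
      also have "\<dots> \<le> 1 / real (Suc n0) + 1 / real (Suc n0)"
        using ij by (intro add_mono divide_left_mono) auto
      also have "\<dots> = 2 / real (Suc n0)" by simp
      also have "\<dots> < q * e\<^sup>2"
      proof -
        have "2 / (q * e\<^sup>2) < real (Suc n0)" using n0 by simp
        then show ?thesis using q \<open>0 < e\<close> by (simp add: field_simps del: of_nat_Suc)
      qed
      finally have "(\<integral>z. (D z)\<^sup>2 * boltz (C z) \<partial>(M \<Otimes>\<^sub>M N)) < e\<^sup>2" using q by simp
      then show ?thesis using \<open>0 < e\<close> by (simp add: field_simps power2_eq_square)
    qed
    finally show "(\<integral>z. norm (?w i z * boltz (C z) - ?w j z * boltz (C z)) \<partial>(M \<Otimes>\<^sub>M N)) < e" by simp
  qed
qed

text \<open>An L1-Cauchy sequence has a subsequence that is Cauchy almost everywhere. Since all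
  potentials stay in a fixed box, dominated convergence then passes to the limit in each of the
  three integrals of the functional.\<close>

lemma bounded_maximizer_exists:
  obtains a b R where "bdd_meas M R a" "bdd_meas N R b" "dual_real M N C a b = dual_sup"
proof -
  obtain a b where a: "\<And>n. bdd_meas M (2 * K) (a n)" and b: "\<And>n. bdd_meas N (2 * K) (b n)"
    and J: "\<And>n. dual_sup - 1 / real (Suc n) < dual_real M N C (a n) (b n)"
    using maximizing_sequence by blast
  note [measurable] = a[THEN bdd_meas_measurable] b[THEN bdd_meas_measurable]
  let ?w = "\<lambda>n z. a n (fst z) + b n (snd z)"
  have "integrable (M \<Otimes>\<^sub>M N) (\<lambda>z. ?w n z * boltz (C z))" for n
  proof (rule P.P.integrable_const_bound[of _ "4 * K"])
    show "AE z in M \<Otimes>\<^sub>M N. norm (?w n z * boltz (C z)) \<le> 4 * K"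
    proof (rule AE_I2)
      fix z assume "z \<in> space (M \<Otimes>\<^sub>M N)"
      then have "\<bar>a n (fst z)\<bar> \<le> 2 * K" "\<bar>b n (snd z)\<bar> \<le> 2 * K"
        using a[of n] b[of n] by (auto simp: bdd_meas_def space_pair_measure)
      then have "\<bar>?w n z\<bar> \<le> 4 * K" by linarith
      then have "\<bar>?w n z\<bar> * boltz (C z) \<le> 4 * K * 1" by (intro mult_mono) (auto simp: K_nonneg)
      then show "norm (?w n z * boltz (C z)) \<le> 4 * K" by (simp add: abs_mult)
    qed
  qed measurable
  then obtain r where r: "strict_mono r"
    and "AE z in M \<Otimes>\<^sub>M N. Cauchy (\<lambda>n. ?w (r n) z * boltz (C z))"
    using cauchy_L1_AE_cauchy_subseq[of "M \<Otimes>\<^sub>M N" "\<lambda>n z. ?w n z * boltz (C z)"]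
      maximizing_sequence_L1_Cauchy[OF a b J] by blast
  from this(2) C_finite_AE have "AE z in M \<Otimes>\<^sub>M N. convergent (\<lambda>n. ?w (r n) z)"
  proof eventually_elim
    case (elim z)
    then have "boltz (C z) \<noteq> 0" using boltz_pos_iff[of "C z"] by simp
    moreover have "convergent (\<lambda>n. boltz (C z) * ?w (r n) z)"
      using elim by (simp add: Cauchy_convergent_iff mult.commute)
    ultimately show ?case by (rule convergent_mult_const_iff[THEN iffD1])
  qed
  from P.AE_pair[OF this]
  have ae: "AE x in M. AE y in N. convergent (\<lambda>n. a (r n) x + b (r n) y)" by simp
  have "\<exists>x0\<in>space M. AE y in N. convergent (\<lambda>n. a (r n) x0 + b (r n) y)"
    using ae by (rule M.AE_imp_ex)
  then obtain x0 where x0: "x0 \<in> space M" and cb: "AE y in N. convergent (\<lambda>n. a (r n) x0 + b (r n) y)"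
    by blast
  text \<open>Only the sums converge; normalising by the value at the fixed point x0 separates them.\<close>
  define a' where "a' = (\<lambda>n x. a (r n) x + - a (r n) x0)"
  define b' where "b' = (\<lambda>n y. b (r n) y - - a (r n) x0)"
  have ca: "AE x in M. convergent (\<lambda>n. a' n x)"
    using ae
  proof eventually_elim
    case (elim x)
    with cb have "AE y in N. convergent (\<lambda>n. a (r n) x + b (r n) y) \<and> convergent (\<lambda>n. a (r n) x0 + b (r n) y)"
      by simp
    from N.AE_imp_ex[OF this] obtain y where
      "convergent (\<lambda>n. a (r n) x + b (r n) y)" "convergent (\<lambda>n. a (r n) x0 + b (r n) y)"
      by blast
    from convergent_diff[OF this] show ?case by (simp add: a'_def)
  qed
  have cb': "AE y in N. convergent (\<lambda>n. b' n y)"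
    using cb by (simp add: b'_def add.commute)
  have x0_le: "\<bar>- a (r n) x0\<bar> \<le> 2 * K" for n using bdd_meas_le[OF a x0, of "r n"] by simp
  have ba: "bdd_meas M (4 * K) (a' n)" for n
    using bdd_meas_shift[OF a x0_le, of "r n" n] by (simp add: a'_def)
  have bb: "bdd_meas N (4 * K) (b' n)" for n
    using bdd_meas_shift[OF b, of "a (r n) x0" "2 * K" "r n"] x0_le[of n] by (simp add: b'_def)
  note [measurable] = ba[THEN bdd_meas_measurable] bb[THEN bdd_meas_measurable]
  \<comment> \<open>Off the convergence set \<open>lim\<close> is an unspecified number. Clipping
    restores a bound at every point and does not change actual limits, since the sequence is bounded
    by \<open>4 * K\<close>: half from the box, half from the reference value.\<close>
  define al where "al = (\<lambda>x. max (- (4 * K)) (min (4 * K) (lim (\<lambda>n. a' n x))))"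
  define bl where "bl = (\<lambda>y. max (- (4 * K)) (min (4 * K) (lim (\<lambda>n. b' n y))))"
  have [measurable]: "al \<in> borel_measurable M" "bl \<in> borel_measurable N"
    unfolding al_def bl_def by measurable
  have bal: "bdd_meas M (4 * K) al" and bbl: "bdd_meas N (4 * K) bl"
    using K_nonneg by (auto simp: bdd_meas_def al_def bl_def)
  have clip: "f \<longlonglongrightarrow> max (- (4 * K)) (min (4 * K) (lim f))"
    if "convergent f" "\<And>n. \<bar>f n\<bar> \<le> 4 * K" for f :: "nat \<Rightarrow> real"
  proof -
    have l: "f \<longlonglongrightarrow> lim f" using that(1) by (simp add: convergent_LIMSEQ_iff)
    have "\<bar>lim f\<bar> \<le> 4 * K"
      using tendsto_rabs[OF l] that(2) by (intro LIMSEQ_le_const2[of "\<lambda>n. \<bar>f n\<bar>"]) auto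
    then have "max (- (4 * K)) (min (4 * K) (lim f)) = lim f" by linarith
    with l show ?thesis by simp
  qed
  have la: "AE x in M. (\<lambda>n. a' n x) \<longlonglongrightarrow> al x"
    using ca
  proof (rule AE_mp, intro AE_I2 impI)
    fix x assume "x \<in> space M" "convergent (\<lambda>n. a' n x)"
    then show "(\<lambda>n. a' n x) \<longlonglongrightarrow> al x"
      unfolding al_def using bdd_meas_le[OF ba] by (intro clip)
  qed
  have lb: "AE y in N. (\<lambda>n. b' n y) \<longlonglongrightarrow> bl y"
    using cb'
  proof (rule AE_mp, intro AE_I2 impI)
    fix y assume "y \<in> space N" "convergent (\<lambda>n. b' n y)"
    then show "(\<lambda>n. b' n y) \<longlonglongrightarrow> bl y"
      unfolding bl_def using bdd_meas_le[OF bb] by (intro clip)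
  qed
  have "(\<lambda>n. \<integral>x. a' n x \<partial>M) \<longlonglongrightarrow> (\<integral>x. al x \<partial>M)"
    by (rule integral_dominated_convergence[where w = "\<lambda>_. 4 * K"])
       (use la ba in \<open>auto simp: bdd_meas_def intro: AE_I2\<close>)
  moreover have "(\<lambda>n. \<integral>y. b' n y \<partial>N) \<longlonglongrightarrow> (\<integral>y. bl y \<partial>N)"
    by (rule integral_dominated_convergence[where w = "\<lambda>_. 4 * K"])
       (use lb bb in \<open>auto simp: bdd_meas_def intro: AE_I2\<close>)
  moreover have "(\<lambda>n. \<integral>z. gibbs (a' n) (b' n) z \<partial>(M \<Otimes>\<^sub>M N)) \<longlonglongrightarrow> (\<integral>z. gibbs al bl z \<partial>(M \<Otimes>\<^sub>M N))"
  proof (rule integral_dominated_convergence[where w = "\<lambda>_. exp (4 * K + 4 * K)"])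
    show "AE z in M \<Otimes>\<^sub>M N. (\<lambda>n. gibbs (a' n) (b' n) z) \<longlonglongrightarrow> gibbs al bl z"
    proof -
      have "AE z in M \<Otimes>\<^sub>M N. (\<lambda>n. a' n (fst z)) \<longlonglongrightarrow> al (fst z)" using la by (rule AE_pair_fst)
      moreover have "AE z in M \<Otimes>\<^sub>M N. (\<lambda>n. b' n (snd z)) \<longlonglongrightarrow> bl (snd z)" using lb by (rule AE_pair_snd)
      ultimately show ?thesis
        by eventually_elim (auto simp: gibbs_def intro!: tendsto_intros)
    qed
    show "AE z in M \<Otimes>\<^sub>M N. norm (gibbs (a' n) (b' n) z) \<le> exp (4 * K + 4 * K)" for n
      by (rule AE_I2) (use gibbs_le[OF ba bb] in simp)
  qed simp_all
  ultimately have lim: "(\<lambda>n. dual_real M N C (a' n) (b' n)) \<longlonglongrightarrow> dual_real M N C al bl"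
    unfolding dual_real_gibbs by (intro tendsto_intros)
  \<comment> \<open>Opposite shifts preserve the functional, so the normalised sequence is still
    maximizing.\<close>
  have eq: "dual_real M N C (a' n) (b' n) = dual_real M N C (a (r n)) (b (r n))" for n
    unfolding a'_def b'_def
    using a b by (intro dual_real_shift) (auto intro: M.bdd_meas_integrable N.bdd_meas_integrable)
  have "(\<lambda>n. dual_sup - 1 / real (Suc n)) \<longlonglongrightarrow> dual_sup - 0"
    by (intro tendsto_intros LIMSEQ_Suc[OF lim_1_over_n])
  moreover have "dual_sup - 1 / real (Suc n) \<le> dual_real M N C (a' n) (b' n)" for n
  proof -
    have "n \<le> r n" using r by (rule strict_mono_imp_increasing)
    then have "1 / real (Suc (r n)) \<le> 1 / real (Suc n)" by (intro divide_left_mono) auto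
    then show ?thesis using J[of "r n"] by (simp only: eq)
  qed
  ultimately have "dual_sup \<le> dual_real M N C al bl"
    using lim by (intro LIMSEQ_le[of _ dual_sup]) auto
  then have "dual_real M N C al bl = dual_sup" using dual_real_le_sup[OF bal bbl] by simp
  then show ?thesis using that[OF bal bbl] by blast
qed

end

section \<open>The Schroedinger system and couplings\<close>

text \<open>All that is kept of the bounded maximizer: its bound and its fixed-point equations,
  written as the statement that the Gibbs density has the prescribed marginals. The equations use
  nonnegative integrals so that Tonelli's theorem applies directly.\<close>

locale schroedinger_system = entropic_transport +
  fixes a :: "'a \<Rightarrow> real" and b :: "'b \<Rightarrow> real" and R :: real
  assumes a_bdd: "bdd_meas M R a" and b_bdd: "bdd_meas N R b"
    and gibbs_fst: "AE x in M. (\<integral>\<^sup>+ y. ennreal (gibbs a b (x, y)) \<partial>N) = 1"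
    and gibbs_snd: "AE y in N. (\<integral>\<^sup>+ x. ennreal (gibbs a b (x, y)) \<partial>M) = 1"

context entropic_transport
begin

lemma nn_integral_gibbs_snd:
  assumes a: "bdd_meas M R a" and y [measurable]: "y \<in> space N"
  shows "(\<integral>\<^sup>+ x. ennreal (gibbs a b (x, y)) \<partial>M) = ennreal (exp (b y) * partition_fun M C a y)"
proof -
  note [measurable] = bdd_meas_measurable[OF a]
  have "integrable M (\<lambda>x. exp (a x) * boltz (C (x, y)))"
  proof (rule M.integrable_const_bound[of _ "exp R"])
    show "AE x in M. norm (exp (a x) * boltz (C (x, y))) \<le> exp R"
    proof (rule AE_I2)
      fix x assume "x \<in> space M"
      then have "a x \<le> R" using bdd_meas_le[OF a] by (simp add: abs_le_iff)
      then have "exp (a x) * boltz (C (x, y)) \<le> exp R * 1" by (intro mult_mono) auto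
      then show "norm (exp (a x) * boltz (C (x, y))) \<le> exp R" by (simp add: abs_mult)
    qed
  qed measurable
  then have i: "integrable M (\<lambda>x. exp (b y) * (exp (a x) * boltz (C (x, y))))" by simp
  have "(\<integral>\<^sup>+ x. ennreal (gibbs a b (x, y)) \<partial>M)
      = (\<integral>\<^sup>+ x. ennreal (exp (b y) * (exp (a x) * boltz (C (x, y)))) \<partial>M)"
    by (simp add: gibbs_def exp_add mult_ac)
  also have "\<dots> = ennreal (\<integral>x. exp (b y) * (exp (a x) * boltz (C (x, y))) \<partial>M)"
    by (rule nn_integral_eq_integral[OF i]) simp
  finally show ?thesis by (simp add: partition_fun_def)
qed

text \<open>Neither potential of a maximizer can be improved by a transform, so the equality case of
  the gap formula identifies each with the transform of the other. The transforms may leave the box,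
  but \<open>dual_sup\<close> bounds the values of all bounded pairs.\<close>

lemma bounded_schroedinger_exists:
  obtains a b R where "schroedinger_system M N C K a b R"
proof -
  obtain a b R where a: "bdd_meas M R a" and b: "bdd_meas N R b" and eq: "dual_real M N C a b = dual_sup"
    by (rule bounded_maximizer_exists)
  interpret S: entropic_transport N M "\<lambda>z. C (snd z, fst z)" K by (rule swap)
  note [measurable] = bdd_meas_measurable[OF a] bdd_meas_measurable[OF b]
  have "AE y in N. b y = ctrans a y"
    using a b by (rule ctrans_eq_of_dual_real_ge)
      (simp add: eq dual_real_le_sup[OF a bdd_meas_ctrans[OF a]])
  then have 1: "AE y in N. (\<integral>\<^sup>+ x. ennreal (gibbs a b (x, y)) \<partial>M) = 1"
  proof (rule AE_mp, intro AE_I2 impI)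
    fix y assume "y \<in> space N" "b y = ctrans a y"
    then show "(\<integral>\<^sup>+ x. ennreal (gibbs a b (x, y)) \<partial>M) = 1"
      using nn_integral_gibbs_snd[OF a, of y b] exp_ctrans[OF a, of y] by simp
  qed
  have m: "S.ctrans b \<in> borel_measurable M" by measurable
  have "AE x in M. a x = S.ctrans b x"
    using b a by (rule S.ctrans_eq_of_dual_real_ge)
      (simp add: eq dual_real_swap m dual_real_le_sup[OF S.bdd_meas_ctrans[OF b] b])
  then have 2: "AE x in M. (\<integral>\<^sup>+ y. ennreal (gibbs a b (x, y)) \<partial>N) = 1"
  proof (rule AE_mp, intro AE_I2 impI)
    fix x assume "x \<in> space M" "a x = S.ctrans b x"
    moreover have "S.gibbs b a (y, x) = gibbs a b (x, y)" for y
      by (simp add: gibbs_def S.gibbs_def add.commute)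
    ultimately show "(\<integral>\<^sup>+ y. ennreal (gibbs a b (x, y)) \<partial>N) = 1"
      using S.nn_integral_gibbs_snd[OF b, of x a] S.exp_ctrans[OF b, of x] by simp
  qed
  have "schroedinger_system M N C K a b R" by unfold_locales (use a b 1 2 in auto)
  then show ?thesis by (rule that)
qed

text \<open>The marginals are taken with respect to the sigma-algebras of \<open>M\<close> and
  \<open>N\<close>, as no topology is present here; for Borel measures this becomes membership in
  \<open>couplings\<close>.\<close>

definition coupling :: "('a \<times> 'b) measure \<Rightarrow> bool" where
  "coupling \<gamma> \<longleftrightarrow> prob_space \<gamma> \<and> sets \<gamma> = sets (M \<Otimes>\<^sub>M N) \<and> distr \<gamma> M fst = M \<and> distr \<gamma> N snd = N"

text \<open>Linear terms do not see which coupling is used. This invariance drives both optimality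
  arguments.\<close>

lemma coupling_integral:
  fixes u :: "'a \<Rightarrow> real" and v :: "'b \<Rightarrow> real"
  assumes "coupling \<gamma>" "integrable M u" "integrable N v"
  shows "integrable \<gamma> (\<lambda>z. u (fst z))" "integrable \<gamma> (\<lambda>z. v (snd z))"
    "(\<integral>z. u (fst z) \<partial>\<gamma>) = (\<integral>x. u x \<partial>M)" "(\<integral>z. v (snd z) \<partial>\<gamma>) = (\<integral>y. v y \<partial>N)"
proof -
  have [measurable_cong]: "sets \<gamma> = sets (M \<Otimes>\<^sub>M N)" and d: "distr \<gamma> M fst = M" "distr \<gamma> N snd = N"
    using assms(1) by (auto simp: coupling_def)
  note [measurable] = borel_measurable_integrable[OF assms(2)] borel_measurable_integrable[OF assms(3)]
  have f: "fst \<in> measurable \<gamma> M" and s: "snd \<in> measurable \<gamma> N" by measurable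
  show "integrable \<gamma> (\<lambda>z. u (fst z))"
    using integrable_distr[OF f, of u] assms(2) by (simp add: d)
  show "integrable \<gamma> (\<lambda>z. v (snd z))"
    using integrable_distr[OF s, of v] assms(3) by (simp add: d)
  show "(\<integral>z. u (fst z) \<partial>\<gamma>) = (\<integral>x. u x \<partial>M)"
    using integral_distr[OF f, of u] assms(2) by (simp add: d)
  show "(\<integral>z. v (snd z) \<partial>\<gamma>) = (\<integral>y. v y \<partial>N)"
    using integral_distr[OF s, of v] assms(3) by (simp add: d)
qed

definition plan :: "('a \<Rightarrow> real) \<Rightarrow> ('b \<Rightarrow> real) \<Rightarrow> ('a \<times> 'b) measure" where
  "plan u v = density (M \<Otimes>\<^sub>M N) (\<lambda>z. ennreal (gibbs u v z))"

text \<open>Fixing a point \<open>x0\<close> whose section satisfies the equation for almost every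
  \<open>y\<close> determines \<open>v\<close>; comparison at a common \<open>y\<close> then
  determines \<open>u\<close> with the opposite constant.\<close>

lemma sum_AE_eq_imp_shift:
  assumes "AE z in M \<Otimes>\<^sub>M N. u (fst z) + v (snd z) = u' (fst z) + (v' (snd z) :: real)"
  obtains t where "AE x in M. u x = u' x + t" "AE y in N. v y = v' y - t"
proof -
  have ae: "AE x in M. AE y in N. u x + v y = u' x + v' y" using P.AE_pair[OF assms] by simp
  from M.AE_imp_ex[OF this] obtain x0 where x0: "AE y in N. u x0 + v y = u' x0 + v' y" by blast
  have "AE x in M. u x = u' x + (u x0 - u' x0)"
    using ae
  proof eventually_elim
    case (elim x)
    with x0 have "AE y in N. u x + v y = u' x + v' y \<and> u x0 + v y = u' x0 + v' y" by simp
    from N.AE_imp_ex[OF this] show ?case by auto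
  qed
  moreover have "AE y in N. v y = v' y - (u x0 - u' x0)" using x0 by eventually_elim simp
  ultimately show ?thesis by (rule that)
qed

end

section \<open>The optimal plan and dual optimality\<close>

context schroedinger_system
begin

lemmas ab_measurable [measurable] = bdd_meas_measurable[OF a_bdd] bdd_meas_measurable[OF b_bdd]

lemma integrable_a: "integrable M a" and integrable_b: "integrable N b"
  using a_bdd b_bdd by (auto intro: M.bdd_meas_integrable N.bdd_meas_integrable)

lemma sets_plan [measurable_cong, simp]: "sets (plan u v) = sets (M \<Otimes>\<^sub>M N)"
  by (simp add: plan_def)

lemma distr_plan_fst: "distr (plan a b) M fst = M"
proof (rule measure_eqI)
  fix A assume "A \<in> sets (distr (plan a b) M fst)"
  then have [measurable]: "A \<in> sets M" by simp
  have v: "fst -` A \<inter> space (M \<Otimes>\<^sub>M N) \<in> sets (M \<Otimes>\<^sub>M N)" by measurable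
  have sp: "space (plan a b) = space (M \<Otimes>\<^sub>M N)" by (simp add: plan_def)
  have "emeasure (distr (plan a b) M fst) A = emeasure (plan a b) (fst -` A \<inter> space (M \<Otimes>\<^sub>M N))"
    by (subst emeasure_distr) (simp_all add: sp)
  also have "\<dots> = (\<integral>\<^sup>+ z. ennreal (gibbs a b z) * indicator (fst -` A \<inter> space (M \<Otimes>\<^sub>M N)) z \<partial>(M \<Otimes>\<^sub>M N))"
    unfolding plan_def by (rule emeasure_density) (use v in auto)
  also have "\<dots> = (\<integral>\<^sup>+ z. ennreal (gibbs a b z) * indicator A (fst z) \<partial>(M \<Otimes>\<^sub>M N))"
    by (rule nn_integral_cong) (auto simp: indicator_def)
  also have "\<dots> = (\<integral>\<^sup>+ x. \<integral>\<^sup>+ y. ennreal (gibbs a b (x, y)) * indicator A x \<partial>N \<partial>M)"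
    by (subst N.nn_integral_fst[symmetric]) auto
  also have "\<dots> = (\<integral>\<^sup>+ x. (\<integral>\<^sup>+ y. ennreal (gibbs a b (x, y)) \<partial>N) * indicator A x \<partial>M)"
    by (intro nn_integral_cong nn_integral_multc) measurable
  also have "\<dots> = (\<integral>\<^sup>+ x. indicator A x \<partial>M)"
    using gibbs_fst by (intro nn_integral_cong_AE) auto
  finally show "emeasure (distr (plan a b) M fst) A = emeasure M A" by simp
qed simp

lemma distr_plan_snd: "distr (plan a b) N snd = N"
proof (rule measure_eqI)
  fix A assume "A \<in> sets (distr (plan a b) N snd)"
  then have [measurable]: "A \<in> sets N" by simp
  have v: "snd -` A \<inter> space (M \<Otimes>\<^sub>M N) \<in> sets (M \<Otimes>\<^sub>M N)" by measurable
  have sp: "space (plan a b) = space (M \<Otimes>\<^sub>M N)" by (simp add: plan_def)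
  have "emeasure (distr (plan a b) N snd) A = emeasure (plan a b) (snd -` A \<inter> space (M \<Otimes>\<^sub>M N))"
    by (subst emeasure_distr) (simp_all add: sp)
  also have "\<dots> = (\<integral>\<^sup>+ z. ennreal (gibbs a b z) * indicator (snd -` A \<inter> space (M \<Otimes>\<^sub>M N)) z \<partial>(M \<Otimes>\<^sub>M N))"
    unfolding plan_def by (rule emeasure_density) (use v in auto)
  also have "\<dots> = (\<integral>\<^sup>+ z. ennreal (gibbs a b z) * indicator A (snd z) \<partial>(M \<Otimes>\<^sub>M N))"
    by (rule nn_integral_cong) (auto simp: indicator_def)
  also have "\<dots> = (\<integral>\<^sup>+ y. \<integral>\<^sup>+ x. ennreal (gibbs a b (x, y)) * indicator A y \<partial>M \<partial>N)"
    by (subst P.nn_integral_snd[symmetric]) auto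
  also have "\<dots> = (\<integral>\<^sup>+ y. (\<integral>\<^sup>+ x. ennreal (gibbs a b (x, y)) \<partial>M) * indicator A y \<partial>N)"
    by (intro nn_integral_cong nn_integral_multc) measurable
  also have "\<dots> = (\<integral>\<^sup>+ y. indicator A y \<partial>N)"
    using gibbs_snd by (intro nn_integral_cong_AE) auto
  finally show "emeasure (distr (plan a b) N snd) A = emeasure N A" by simp
qed simp

lemma prob_space_plan: "prob_space (plan a b)"
proof (rule prob_spaceI)
  have "emeasure M (space M) = emeasure (distr (plan a b) M fst) (space M)" by (simp add: distr_plan_fst)
  also have "\<dots> = emeasure (plan a b) (fst -` space M \<inter> space (plan a b))"
    by (rule emeasure_distr) auto
  also have "fst -` space M \<inter> space (plan a b) = space (plan a b)"
    by (auto simp: plan_def space_pair_measure)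
  finally show "emeasure (plan a b) (space (plan a b)) = 1" by (simp add: M.emeasure_space_1)
qed

lemma coupling_plan: "coupling (plan a b)"
  by (simp add: coupling_def distr_plan_fst distr_plan_snd prob_space_plan)

text \<open>The quotient of two Gibbs densities is the exponential of the difference of the sums:
  the Boltzmann weight cancels where it is positive, and both densities vanish where it is 0. The
  Gibbs mass of any pair thus becomes an exponential moment under the optimal plan.\<close>

lemma nn_integral_gibbs_plan:
  assumes [measurable]: "u \<in> borel_measurable M" "v \<in> borel_measurable N"
  shows "(\<integral>\<^sup>+ z. ennreal (gibbs u v z) \<partial>(M \<Otimes>\<^sub>M N))
    = (\<integral>\<^sup>+ z. ennreal (exp ((u (fst z) + v (snd z)) - (a (fst z) + b (snd z)))) \<partial>plan a b)"
  unfolding plan_def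
  by (subst nn_integral_density)
    (auto intro!: nn_integral_cong simp: gibbs_def exp_diff simp flip: ennreal_mult')

lemma AE_plan_imp_AE:
  assumes "AE z in plan a b. Q z" shows "AE z in M \<Otimes>\<^sub>M N. Q z"
proof -
  have "AE z in M \<Otimes>\<^sub>M N. 0 < ennreal (gibbs a b z) \<longrightarrow> Q z"
    using assms unfolding plan_def by (subst (asm) AE_density) auto
  with C_finite_AE show ?thesis
  proof eventually_elim
    case (elim z)
    then have "0 < gibbs a b z" using boltz_pos_iff[of "C z"] by (simp add: gibbs_def)
    then show ?case using elim by simp
  qed
qed

text \<open>With \<open>d\<close> the difference of the sums, \<open>I\<close> is the integral of
  \<open>exp d\<close> under the plan, while the marginals give the integral of \<open>d\<close>.
  The deficit is therefore the integral of \<open>exp d - (1 + d)\<close>, and it is 0 only if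
  \<open>d\<close> vanishes almost everywhere.\<close>

lemma dual_optimal:
  assumes u: "integrable M u" and v: "integrable N v"
    and fin: "(\<integral>\<^sup>+ z. ennreal (gibbs u v z) \<partial>(M \<Otimes>\<^sub>M N)) = ennreal I" and "0 \<le> I"
  shows "(\<integral>x. u x \<partial>M) + (\<integral>y. v y \<partial>N) - I \<le> (\<integral>x. a x \<partial>M) + (\<integral>y. b y \<partial>N) - 1"
    and "(\<integral>x. u x \<partial>M) + (\<integral>y. v y \<partial>N) - I = (\<integral>x. a x \<partial>M) + (\<integral>y. b y \<partial>N) - 1 \<Longrightarrow>
      \<exists>t. (AE x in M. u x = a x + t) \<and> (AE y in N. v y = b y - t)"
proof -
  let ?lhs = "(\<integral>x. u x \<partial>M) + (\<integral>y. v y \<partial>N) - I"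
  let ?rhs = "(\<integral>x. a x \<partial>M) + (\<integral>y. b y \<partial>N) - 1"
  interpret G: prob_space "plan a b" by (rule prob_space_plan)
  note [measurable] = borel_measurable_integrable[OF u] borel_measurable_integrable[OF v]
  define d where "d z = (u (fst z) + v (snd z)) - (a (fst z) + b (snd z))" for z
  note iu = coupling_integral[OF coupling_plan u v]
  note ia = coupling_integral[OF coupling_plan integrable_a integrable_b]
  have [measurable]: "d \<in> borel_measurable (plan a b)" unfolding d_def by measurable
  have id: "integrable (plan a b) d" unfolding d_def using iu ia by simp
  have int_d: "(\<integral>z. d z \<partial>plan a b) = (\<integral>x. u x \<partial>M) + (\<integral>y. v y \<partial>N) - ((\<integral>x. a x \<partial>M) + (\<integral>y. b y \<partial>N))"
    unfolding d_def using iu ia by simp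
  have nn: "(\<integral>\<^sup>+ z. ennreal (exp (d z)) \<partial>plan a b) = ennreal I"
    using fin nn_integral_gibbs_plan[of u v] by (simp add: d_def)
  have ie: "integrable (plan a b) (\<lambda>z. exp (d z))"
    by (rule integrableI_nonneg) (auto simp: nn)
  have int_e: "(\<integral>z. exp (d z) \<partial>plan a b) = I"
    using nn nn_integral_eq_integral[OF ie] \<open>0 \<le> I\<close> by (simp add: integral_nonneg_AE)
  let ?f = "\<lambda>z. exp (d z) - (1 + d z)"
  have nnf: "0 \<le> ?f z" for z using exp_ge_add_one_self[of "d z"] by simp
  have if': "integrable (plan a b) ?f" using ie id by simp
  have int_f: "(\<integral>z. ?f z \<partial>plan a b) = ?rhs - ?lhs"
    using ie id by (simp add: int_e int_d G.prob_space)
  have "0 \<le> (\<integral>z. ?f z \<partial>plan a b)" by (rule Bochner_Integration.integral_nonneg) (rule nnf)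
  then show "?lhs \<le> ?rhs" unfolding int_f by simp
  assume "?lhs = ?rhs"
  then have "(\<integral>z. ?f z \<partial>plan a b) = 0" unfolding int_f by simp
  then have "AE z in plan a b. ?f z = 0"
    using integral_nonneg_eq_0_iff_AE[OF if'] nnf by simp
  then have "AE z in plan a b. u (fst z) + v (snd z) = a (fst z) + b (snd z)"
  proof eventually_elim
    case (elim z)
    then have "exp (d z) = 1 + d z" by linarith
    then have "d z = 0" by (simp only: exp_eq_tangent_iff)
    then show ?case by (simp add: d_def)
  qed
  from sum_AE_eq_imp_shift[OF AE_plan_imp_AE[OF this]]
  show "\<exists>t. (AE x in M. u x = a x + t) \<and> (AE y in N. v y = b y - t)" by metis
qed

end

section \<open>Entropy and primal optimality\<close>

lemma xlogx_ge: "0 \<le> r \<Longrightarrow> r - 1 \<le> r * ln r" for r :: real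
proof (cases "r = 0")
  case False
  assume "0 \<le> r"
  with False have "0 < r" by simp
  then have "ln (1 / r) \<le> 1 / r - 1" by (intro ln_le_minus_one) simp
  then have "r * (1 - 1 / r) \<le> r * ln r" using \<open>0 < r\<close> by (intro mult_left_mono) (simp_all add: ln_div)
  then show ?thesis using \<open>0 < r\<close> by (simp add: right_diff_distrib)
qed simp

text \<open>The Fenchel-Young inequality for the conjugate functions \<open>r * ln r - r\<close> and
  \<open>exp s\<close>. At \<open>r = 0\<close>, with \<open>ln 0 = 0\<close>, it reads
  \<open>- exp s \<le> 0\<close> and is strict, so equality excludes this case.\<close>

lemma xlogx_tangent:
  fixes r s :: real
  assumes "0 \<le> r"
  shows "r - exp s \<le> r * ln r - r * s"
    and "r - exp s = r * ln r - r * s \<Longrightarrow> r = exp s"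
proof -
  show "r - exp s \<le> r * ln r - r * s"
  proof (cases "r = 0")
    case False
    with assms have "0 < r" by simp
    have "r * (1 + (s - ln r)) \<le> r * exp (s - ln r)"
      using \<open>0 < r\<close> by (intro mult_left_mono exp_ge_add_one_self) simp
    then show ?thesis using \<open>0 < r\<close> by (simp add: exp_diff algebra_simps)
  qed simp
  assume eq: "r - exp s = r * ln r - r * s"
  show "r = exp s"
  proof (cases "r = 0")
    case True
    with eq show ?thesis by simp
  next
    case False
    with assms have "0 < r" by simp
    have "exp s = r * exp (s - ln r)" using \<open>0 < r\<close> by (simp add: exp_diff)
    with eq have "r * exp (s - ln r) = r * (1 + (s - ln r))" by (simp add: algebra_simps)
    then have "exp (s - ln r) = 1 + (s - ln r)" using \<open>0 < r\<close> by simp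
    then have "s = ln r" by (simp only: exp_eq_tangent_iff)
    then show ?thesis using \<open>0 < r\<close> by simp
  qed
qed

context entropic_transport
begin

definition cost :: "('a \<times> 'b) measure \<Rightarrow> ereal" where
  "cost \<gamma> = enn2ereal (\<integral>\<^sup>+ z. C z \<partial>\<gamma>) + relative_entropy \<gamma> (M \<Otimes>\<^sub>M N)"

text \<open>Radon-Nikodym derivatives are unique almost everywhere, and both integrals in
  \<open>ext_integral\<close> ignore null sets, so any chosen real density computes the
  entropy.\<close>

lemma relative_entropy_density:
  assumes [measurable]: "r \<in> borel_measurable (M \<Otimes>\<^sub>M N)" and nn: "\<And>z. 0 \<le> r z"
    and g: "\<gamma> = density (M \<Otimes>\<^sub>M N) (\<lambda>z. ennreal (r z))"
  shows "relative_entropy \<gamma> (M \<Otimes>\<^sub>M N) = ext_integral (M \<Otimes>\<^sub>M N) (\<lambda>z. r z * ln (r z))"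
proof -
  have ac: "absolutely_continuous (M \<Otimes>\<^sub>M N) \<gamma>"
    unfolding g by (rule absolutely_continuousI_density) measurable
  have "AE z in M \<Otimes>\<^sub>M N. ennreal (r z) = RN_deriv (M \<Otimes>\<^sub>M N) \<gamma> z"
    by (rule P.P.RN_deriv_unique) (simp_all add: g)
  then have "AE z in M \<Otimes>\<^sub>M N. enn2real (RN_deriv (M \<Otimes>\<^sub>M N) \<gamma> z) = r z"
    by eventually_elim (metis enn2real_ennreal nn)
  then have "(\<integral>\<^sup>+ z. ennreal (enn2real (RN_deriv (M \<Otimes>\<^sub>M N) \<gamma> z) * ln (enn2real (RN_deriv (M \<Otimes>\<^sub>M N) \<gamma> z))) \<partial>(M \<Otimes>\<^sub>M N))
      = (\<integral>\<^sup>+ z. ennreal (r z * ln (r z)) \<partial>(M \<Otimes>\<^sub>M N))"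
    "(\<integral>\<^sup>+ z. ennreal (- (enn2real (RN_deriv (M \<Otimes>\<^sub>M N) \<gamma> z) * ln (enn2real (RN_deriv (M \<Otimes>\<^sub>M N) \<gamma> z)))) \<partial>(M \<Otimes>\<^sub>M N))
      = (\<integral>\<^sup>+ z. ennreal (- (r z * ln (r z))) \<partial>(M \<Otimes>\<^sub>M N))"
    by (auto intro!: nn_integral_cong_AE)
  then show ?thesis using ac by (simp add: relative_entropy_def ext_integral_def)
qed

text \<open>The tangent at 1 gives \<open>- r * ln r \<le> 1 - r \<le> 1\<close>. Hence
  \<open>ext_integral\<close> never subtracts infinity from infinity for such integrands.\<close>

lemma xlogx_neg_part_le:
  assumes nn: "\<And>z. 0 \<le> r z"
  shows "(\<integral>\<^sup>+ z. ennreal (- (r z * ln (r z))) \<partial>(M \<Otimes>\<^sub>M N)) \<le> 1"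
proof -
  have "(\<integral>\<^sup>+ z. ennreal (- (r z * ln (r z))) \<partial>(M \<Otimes>\<^sub>M N)) \<le> (\<integral>\<^sup>+ z. 1 \<partial>(M \<Otimes>\<^sub>M N))"
  proof (rule nn_integral_mono)
    fix z
    have "- (r z * ln (r z)) \<le> 1" using xlogx_ge[OF nn[of z]] nn[of z] by linarith
    then show "ennreal (- (r z * ln (r z))) \<le> 1" by (metis ennreal_1 ennreal_leI)
  qed
  then show ?thesis by (simp add: P.P.emeasure_space_1)
qed

text \<open>The transport term is nonnegative and the negative part of the entropy is finite, so an
  infinite term cannot be cancelled.\<close>

lemma cost_density_infinite:
  assumes r [measurable]: "r \<in> borel_measurable (M \<Otimes>\<^sub>M N)" and nn: "\<And>z. 0 \<le> r z"
    and g: "\<gamma> = density (M \<Otimes>\<^sub>M N) (\<lambda>z. ennreal (r z))"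
    and inf: "(\<integral>\<^sup>+ z. C z \<partial>\<gamma>) = \<infinity> \<or> (\<integral>\<^sup>+ z. ennreal (r z * ln (r z)) \<partial>(M \<Otimes>\<^sub>M N)) = \<infinity>"
  shows "cost \<gamma> = \<infinity>"
proof -
  let ?n = "enn2ereal (\<integral>\<^sup>+ z. ennreal (- (r z * ln (r z))) \<partial>(M \<Otimes>\<^sub>M N))"
  let ?p = "enn2ereal (\<integral>\<^sup>+ z. ennreal (r z * ln (r z)) \<partial>(M \<Otimes>\<^sub>M N))"
  let ?c = "enn2ereal (\<integral>\<^sup>+ z. C z \<partial>\<gamma>)"
  have "(\<integral>\<^sup>+ z. ennreal (- (r z * ln (r z))) \<partial>(M \<Otimes>\<^sub>M N)) \<noteq> \<infinity>"
    using xlogx_neg_part_le[of r, OF nn] by (auto simp: top_unique)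
  then obtain n where n: "?n = ereal n"
    by (cases "\<integral>\<^sup>+ z. ennreal (- (r z * ln (r z))) \<partial>(M \<Otimes>\<^sub>M N)") auto
  have "cost \<gamma> = ?c + (?p - ereal n)"
    using n by (simp add: cost_def relative_entropy_density[OF r nn g] ext_integral_def)
  moreover have "?c = \<infinity> \<or> ?p = \<infinity>" using inf by auto
  moreover have "0 \<le> ?c" "0 \<le> ?p" by auto
  ultimately show ?thesis by (cases ?c; cases ?p) auto
qed

lemma cost_density:
  assumes r [measurable]: "r \<in> borel_measurable (M \<Otimes>\<^sub>M N)" and nn: "\<And>z. 0 \<le> r z"
    and g: "\<gamma> = density (M \<Otimes>\<^sub>M N) (\<lambda>z. ennreal (r z))"
    and fin: "(\<integral>\<^sup>+ z. C z \<partial>\<gamma>) \<noteq> \<infinity>" "(\<integral>\<^sup>+ z. ennreal (r z * ln (r z)) \<partial>(M \<Otimes>\<^sub>M N)) \<noteq> \<infinity>"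
  shows "integrable (M \<Otimes>\<^sub>M N) (\<lambda>z. r z * ln (r z))"
    and "integrable (M \<Otimes>\<^sub>M N) (\<lambda>z. r z * enn2real (C z))"
    and "cost \<gamma> = ereal ((\<integral>z. r z * enn2real (C z) \<partial>(M \<Otimes>\<^sub>M N)) + (\<integral>z. r z * ln (r z) \<partial>(M \<Otimes>\<^sub>M N)))"
proof -
  have neg: "(\<integral>\<^sup>+ z. ennreal (- (r z * ln (r z))) \<partial>(M \<Otimes>\<^sub>M N)) \<noteq> \<infinity>"
    using xlogx_neg_part_le[of r, OF nn] by (auto simp: top_unique)
  show il: "integrable (M \<Otimes>\<^sub>M N) (\<lambda>z. r z * ln (r z))"
    unfolding real_integrable_def using fin(2) neg by auto
  have ext: "ext_integral (M \<Otimes>\<^sub>M N) (\<lambda>z. r z * ln (r z)) = ereal (\<integral>z. r z * ln (r z) \<partial>(M \<Otimes>\<^sub>M N))"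
  proof -
    obtain p where p: "(\<integral>\<^sup>+ z. ennreal (r z * ln (r z)) \<partial>(M \<Otimes>\<^sub>M N)) = ennreal p" "0 \<le> p"
      using fin(2) by (cases "\<integral>\<^sup>+ z. ennreal (r z * ln (r z)) \<partial>(M \<Otimes>\<^sub>M N)" rule: ennreal_cases) auto
    obtain n where n: "(\<integral>\<^sup>+ z. ennreal (- (r z * ln (r z))) \<partial>(M \<Otimes>\<^sub>M N)) = ennreal n" "0 \<le> n"
      using neg by (cases "\<integral>\<^sup>+ z. ennreal (- (r z * ln (r z))) \<partial>(M \<Otimes>\<^sub>M N)" rule: ennreal_cases) auto
    show ?thesis
      by (simp add: ext_integral_def real_lebesgue_integral_def[OF il] p n enn2ereal_ennreal)
  qed
  have C: "(\<integral>\<^sup>+ z. C z \<partial>\<gamma>) = (\<integral>\<^sup>+ z. ennreal (r z * enn2real (C z)) \<partial>(M \<Otimes>\<^sub>M N))"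
    unfolding g
  proof (subst nn_integral_density)
    show "(\<integral>\<^sup>+ z. ennreal (r z) * C z \<partial>(M \<Otimes>\<^sub>M N)) = (\<integral>\<^sup>+ z. ennreal (r z * enn2real (C z)) \<partial>(M \<Otimes>\<^sub>M N))"
    proof (rule nn_integral_cong_AE)
      show "AE z in M \<Otimes>\<^sub>M N. ennreal (r z) * C z = ennreal (r z * enn2real (C z))"
        using C_finite_AE by eventually_elim (simp add: ennreal_mult' nn top.not_eq_extremum)
    qed
  qed measurable
  show ic: "integrable (M \<Otimes>\<^sub>M N) (\<lambda>z. r z * enn2real (C z))"
    by (rule integrableI_nonneg) (use fin(1) nn in \<open>auto simp: C top.not_eq_extremum\<close>)
  have "(\<integral>\<^sup>+ z. C z \<partial>\<gamma>) = ennreal (\<integral>z. r z * enn2real (C z) \<partial>(M \<Otimes>\<^sub>M N))"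
    unfolding C by (rule nn_integral_eq_integral[OF ic]) (simp add: nn)
  moreover have "0 \<le> (\<integral>z. r z * enn2real (C z) \<partial>(M \<Otimes>\<^sub>M N))"
    by (rule Bochner_Integration.integral_nonneg) (simp add: nn)
  ultimately show "cost \<gamma> = ereal ((\<integral>z. r z * enn2real (C z) \<partial>(M \<Otimes>\<^sub>M N)) + (\<integral>z. r z * ln (r z) \<partial>(M \<Otimes>\<^sub>M N)))"
    by (simp add: cost_def relative_entropy_density[OF r nn g] ext enn2ereal_ennreal)
qed

end

context schroedinger_system
begin

text \<open>The common optimal value divided by \<epsilon>: the Gibbs mass is 1 and cancels the
  additive constant of the dual functional.\<close>

definition opt_value :: real where
  "opt_value = (\<integral>x. a x \<partial>M) + (\<integral>y. b y \<partial>N)"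

lemma R_nonneg: "0 \<le> R"
  using M.bdd_meas_expectation[OF a_bdd] by linarith

lemma gibbs_exp:
  "C z \<noteq> \<infinity> \<Longrightarrow> gibbs a b z = exp (a (fst z) + b (snd z) - enn2real (C z))"
  by (simp add: gibbs_def boltz_def exp_diff exp_minus divide_inverse)

text \<open>When the cost is finite, its excess over \<open>opt_value\<close> is the relative
  entropy of the coupling with respect to \<open>plan a b\<close>, written as the integral of a
  nonnegative function that vanishes only where the two densities agree.\<close>

lemma coupling_cost:
  assumes \<gamma>: "coupling \<gamma>"
  shows "ereal opt_value \<le> cost \<gamma>" and "cost \<gamma> = ereal opt_value \<Longrightarrow> \<gamma> = plan a b"
proof -
  let ?P = "M \<Otimes>\<^sub>M N"
  interpret g: prob_space \<gamma> using \<gamma> by (simp add: coupling_def)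
  have sets [measurable_cong]: "sets \<gamma> = sets ?P" using \<gamma> by (simp add: coupling_def)
  have "ereal opt_value \<le> cost \<gamma> \<and> (cost \<gamma> = ereal opt_value \<longrightarrow> \<gamma> = plan a b)"
  proof (cases "absolutely_continuous ?P \<gamma>")
    case False
    then have "cost \<gamma> = \<infinity>" by (simp add: cost_def relative_entropy_def)
    then show ?thesis by simp
  next
    case True
    define r where "r z = enn2real (RN_deriv ?P \<gamma> z)" for z
    have r [measurable]: "r \<in> borel_measurable ?P" unfolding r_def by measurable
    have nn: "0 \<le> r z" for z by (simp add: r_def)
    \<comment> \<open>The derivative could be infinite on a null set, where \<open>r\<close> takes
      the default value 0 of \<open>enn2real\<close>; the measure with density \<open>r\<close> is
      not affected.\<close>
    have "AE z in ?P. RN_deriv ?P \<gamma> z \<noteq> \<infinity>"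
      by (rule P.P.RN_deriv_finite) (use True sets g.sigma_finite_measure_axioms in auto)
    then have "AE z in ?P. RN_deriv ?P \<gamma> z = ennreal (r z)"
      by eventually_elim (simp add: r_def top.not_eq_extremum)
    then have "density ?P (RN_deriv ?P \<gamma>) = density ?P (\<lambda>z. ennreal (r z))"
      by (intro density_cong) auto
    then have g: "\<gamma> = density ?P (\<lambda>z. ennreal (r z))"
      using P.P.density_RN_deriv[OF True] sets by simp
    show ?thesis
    proof (cases "(\<integral>\<^sup>+ z. C z \<partial>\<gamma>) = \<infinity> \<or> (\<integral>\<^sup>+ z. ennreal (r z * ln (r z)) \<partial>?P) = \<infinity>")
      case True
      from cost_density_infinite[OF r nn g True] show ?thesis by simp
    next
      case False
      then have fin: "(\<integral>\<^sup>+ z. C z \<partial>\<gamma>) \<noteq> \<infinity>" "(\<integral>\<^sup>+ z. ennreal (r z * ln (r z)) \<partial>?P) \<noteq> \<infinity>" by auto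
      note c = cost_density[OF r nn g fin]
      let ?w = "\<lambda>z. a (fst z) + b (snd z)"
      note ia = coupling_integral[OF \<gamma> integrable_a integrable_b]
      have "integrable \<gamma> ?w" using ia by simp
      then have iw: "integrable ?P (\<lambda>z. r z * ?w z)"
        unfolding g by (subst (asm) integrable_density) (auto simp: nn)
      have "(\<integral>z. ?w z \<partial>\<gamma>) = (\<integral>z. r z * ?w z \<partial>?P)"
        unfolding g by (subst integral_density) (auto simp: nn)
      then have int_w: "(\<integral>z. r z * ?w z \<partial>?P) = opt_value"
        using ia by (simp add: opt_value_def)
      have nr: "(\<integral>\<^sup>+ z. ennreal (r z) \<partial>?P) = 1"
      proof -
        have "(\<integral>\<^sup>+ z. ennreal (r z) \<partial>?P) = emeasure \<gamma> (space ?P)"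
          unfolding g by (subst emeasure_density) (auto intro!: nn_integral_cong)
        also have "space ?P = space \<gamma>" using sets by (rule sets_eq_imp_space_eq[symmetric])
        finally show ?thesis by (simp add: g.emeasure_space_1)
      qed
      have ir: "integrable ?P r" by (rule integrableI_nonneg) (auto simp: nn nr)
      have int_r: "(\<integral>z. r z \<partial>?P) = 1"
        using nr nn_integral_eq_integral[OF ir] nn by (simp add: Bochner_Integration.integral_nonneg)
      interpret G: prob_space "plan a b" by (rule prob_space_plan)
      have iq: "integrable ?P (gibbs a b)" by (rule integrable_gibbs[OF a_bdd b_bdd])
      have nq: "(\<integral>\<^sup>+ z. ennreal (gibbs a b z) \<partial>?P) = 1"
        using nn_integral_gibbs_plan[of a b] G.emeasure_space_1 by simp
      have int_q: "(\<integral>z. gibbs a b z \<partial>?P) = 1"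
        using nq nn_integral_eq_integral[OF iq] by (simp add: Bochner_Integration.integral_nonneg)
      \<comment> \<open>Both densities have mass 1, so subtracting \<open>r z - gibbs a b z\<close>
        does not change the integral; it makes the integrand nonnegative by Fenchel-Young at
        \<open>s = ?w z - C z\<close>.\<close>
      let ?f = "\<lambda>z. (r z * ln (r z) + r z * enn2real (C z) - r z * ?w z) - (r z - gibbs a b z)"
      have if': "integrable ?P ?f" using c(1,2) iw ir iq by simp
      have cost: "cost \<gamma> = ereal (opt_value + (\<integral>z. ?f z \<partial>?P))"
        using c(1,2) iw ir iq by (simp add: c(3) int_w int_r int_q)
      have tan: "0 \<le> ?f z" "?f z = 0 \<Longrightarrow> r z = gibbs a b z" if "C z \<noteq> \<infinity>" for z
        using xlogx_tangent[OF nn[of z], of "?w z - enn2real (C z)"]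
        by (auto simp: gibbs_exp[OF that] algebra_simps)
      have nnf: "AE z in ?P. 0 \<le> ?f z" using C_finite_AE by eventually_elim (rule tan)
      have "0 \<le> (\<integral>z. ?f z \<partial>?P)" using nnf by (rule integral_nonneg_AE)
      moreover have "\<gamma> = plan a b" if "(\<integral>z. ?f z \<partial>?P) = 0"
      proof -
        have "AE z in ?P. ?f z = 0" using integral_nonneg_eq_0_iff_AE[OF if' nnf] that by simp
        then have "AE z in ?P. ennreal (r z) = ennreal (gibbs a b z)"
          using C_finite_AE
        proof eventually_elim
          case (elim z)
          from tan(2)[OF elim(2,1)] show ?case by simp
        qed
        then show ?thesis unfolding g plan_def by (intro density_cong) auto
      qed
      ultimately show ?thesis by (simp add: cost)
    qed
  qed
  then show "ereal opt_value \<le> cost \<gamma>" "cost \<gamma> = ereal opt_value \<Longrightarrow> \<gamma> = plan a b" by auto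
qed

text \<open>The bound \<open>exp (2 * R)\<close> on the density makes transport and entropy terms
  finite. Since the logarithm of the density is \<open>a + b - C\<close>, the cost cancels, and the
  marginals evaluate what remains.\<close>

lemma cost_plan: "cost (plan a b) = ereal opt_value"
proof -
  let ?P = "M \<Otimes>\<^sub>M N"
  let ?w = "\<lambda>z. a (fst z) + b (snd z)"
  have le: "gibbs a b z \<le> exp (2 * R)" if "z \<in> space ?P" for z
    using gibbs_le[OF a_bdd b_bdd that] by simp
  have m: "gibbs a b \<in> borel_measurable ?P" by measurable
  have "(\<integral>\<^sup>+ z. C z \<partial>plan a b) = (\<integral>\<^sup>+ z. ennreal (gibbs a b z) * C z \<partial>?P)"
    unfolding plan_def by (rule nn_integral_density) measurable
  also have "\<dots> \<le> (\<integral>\<^sup>+ z. ennreal (exp (2 * R)) * C z \<partial>?P)"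
    by (intro nn_integral_mono mult_right_mono ennreal_leI le) auto
  also have "\<dots> = ennreal (exp (2 * R)) * (\<integral>\<^sup>+ z. C z \<partial>?P)"
    by (rule nn_integral_cmult) measurable
  also have "\<dots> \<le> ennreal (exp (2 * R)) * ennreal K"
    by (intro mult_left_mono C_nn_integral_le) auto
  finally have fin1: "(\<integral>\<^sup>+ z. C z \<partial>plan a b) \<noteq> \<infinity>"
    by (auto simp: top_unique ennreal_mult_eq_top_iff)
  have "(\<integral>\<^sup>+ z. ennreal (gibbs a b z * ln (gibbs a b z)) \<partial>?P) \<le> (\<integral>\<^sup>+ z. ennreal (exp (2 * R) * (2 * R)) \<partial>?P)"
  proof (rule nn_integral_mono, rule ennreal_leI)
    fix z assume z: "z \<in> space ?P"
    show "gibbs a b z * ln (gibbs a b z) \<le> exp (2 * R) * (2 * R)"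
    proof (cases "gibbs a b z = 0")
      case False
      then have pos: "0 < gibbs a b z" using gibbs_nonneg[of a b z] by linarith
      have "ln (gibbs a b z) \<le> 2 * R" using ln_mono[OF le[OF z] pos] by simp
      then have "gibbs a b z * ln (gibbs a b z) \<le> gibbs a b z * (2 * R)"
        using pos by (intro mult_left_mono) auto
      also have "\<dots> \<le> exp (2 * R) * (2 * R)" using le[OF z] R_nonneg by (intro mult_right_mono) auto
      finally show ?thesis .
    qed (simp add: R_nonneg)
  qed
  then have fin2: "(\<integral>\<^sup>+ z. ennreal (gibbs a b z * ln (gibbs a b z)) \<partial>?P) \<noteq> \<infinity>"
    by (auto simp: P.P.emeasure_space_1 top_unique)
  note c = cost_density[OF m gibbs_nonneg plan_def fin1 fin2]
  note ia = coupling_integral[OF coupling_plan integrable_a integrable_b]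
  have "(\<integral>z. gibbs a b z * enn2real (C z) \<partial>?P) + (\<integral>z. gibbs a b z * ln (gibbs a b z) \<partial>?P)
      = (\<integral>z. gibbs a b z * enn2real (C z) + gibbs a b z * ln (gibbs a b z) \<partial>?P)"
    using c(1,2) by simp
  also have "\<dots> = (\<integral>z. gibbs a b z * ?w z \<partial>?P)"
  proof (rule integral_cong_AE)
    show "AE z in ?P. gibbs a b z * enn2real (C z) + gibbs a b z * ln (gibbs a b z) = gibbs a b z * ?w z"
      using C_finite_AE by eventually_elim (simp add: gibbs_exp algebra_simps)
  qed measurable
  also have "\<dots> = (\<integral>z. ?w z \<partial>plan a b)"
    unfolding plan_def by (subst integral_density) auto
  also have "\<dots> = opt_value" using ia by (simp add: opt_value_def)
  finally show ?thesis by (simp add: c(3))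
qed

end

section \<open>Return to the original cost and parameter\<close>

text \<open>Strict superlevel sets are open: the lower limit controls a punctured neighbourhood, and
  the centre satisfies the inequality by choice.\<close>

lemma lower_semicontinuous_measurable:
  fixes f :: "'a::topological_space \<Rightarrow> 'b::{complete_linorder, linorder_topology, second_countable_topology}"
  assumes "lower_semicontinuous f"
  shows "f \<in> borel_measurable borel"
proof (rule borel_measurableI_greater)
  fix t
  have "\<forall>\<^sub>F w in nhds z. t < f w" if "t < f z" for z
  proof -
    have "t < Liminf (at z) f"
      using that assms unfolding lower_semicontinuous_def by (blast intro: less_le_trans)
    then have "\<forall>\<^sub>F w in at z. t < f w" by (rule less_LiminfD)
    then show ?thesis using that by (auto simp: eventually_at_filter elim: eventually_mono)
  qed
  then have "open {z. t < f z}"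
    by (subst open_subopen) (fastforce simp: eventually_nhds)
  then show "{z \<in> space borel. t < f z} \<in> sets borel" by simp
qed

text \<open>The normalisation equation rules out the values 0 and infinity of \<open>I\<close>, so
  \<open>elog\<close> reduces to a real logarithm.\<close>

lemma elog_eqI:
  assumes "0 < \<epsilon>" "ennreal (exp (s / \<epsilon>)) * I = 1"
  shows "ereal s = - ereal \<epsilon> * elog I"
proof (cases I rule: ennreal_cases)
  case (real i)
  have "ennreal (exp (s / \<epsilon>) * i) = ennreal 1"
    using assms(2) real by (simp add: ennreal_mult)
  then have e: "exp (s / \<epsilon>) * i = 1" using real by (subst (asm) ennreal_inj) auto
  then have "i = exp (- (s / \<epsilon>))" by (simp add: exp_minus field_simps)
  then show ?thesis using \<open>0 < \<epsilon>\<close> real by (simp add: elog_def)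
next
  case top
  then show ?thesis using assms(2) by (simp add: ennreal_mult_eq_top_iff ennreal_mult_top)
qed

context entropic_transport
begin

lemma gibbs_kernel_scaled:
  assumes C: "C = (\<lambda>z. c z / ennreal \<epsilon>)" and \<epsilon>: "0 < \<epsilon>"
  shows "gibbs_kernel c \<epsilon> u v z = ennreal (gibbs (\<lambda>x. u x / \<epsilon>) (\<lambda>y. v y / \<epsilon>) z)"
proof (cases "c z" rule: ennreal_cases)
  case (real t)
  then have "C z = ennreal (t / \<epsilon>)" using \<epsilon> by (simp add: C divide_ennreal)
  then have "boltz (C z) = exp (- (t / \<epsilon>))" using \<epsilon> real by (simp add: boltz_def)
  then have "gibbs (\<lambda>x. u x / \<epsilon>) (\<lambda>y. v y / \<epsilon>) z = exp ((u (fst z) + v (snd z) - t) / \<epsilon>)"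
    by (simp add: gibbs_def add_divide_distrib diff_divide_distrib flip: exp_add)
  then show ?thesis using real \<epsilon> by (cases z) (simp add: gibbs_kernel_def enn2ereal_ennreal eexp_def)
next
  case top
  then have "C z = \<infinity>" using \<epsilon> by (simp add: C ennreal_top_divide)
  then show ?thesis using top \<epsilon>
    by (cases z) (simp add: gibbs_kernel_def gibbs_def boltz_def eexp_def)
qed

lemma entropic_cost_scaled:
  assumes C: "C = (\<lambda>z. c z / ennreal \<epsilon>)" and \<epsilon>: "0 < \<epsilon>"
    and [measurable_cong]: "sets \<gamma> = sets (M \<Otimes>\<^sub>M N)"
  shows "entropic_cost M N c \<epsilon> \<gamma> = ereal \<epsilon> * cost \<gamma>"
proof -
  have "c z = ennreal \<epsilon> * C z" for z
    using \<epsilon> by (cases "c z" rule: ennreal_cases)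
      (simp_all add: C divide_ennreal ennreal_top_divide ennreal_mult_top flip: ennreal_mult')
  then have "(\<integral>\<^sup>+ z. c z \<partial>\<gamma>) = (\<integral>\<^sup>+ z. ennreal \<epsilon> * C z \<partial>\<gamma>)" by simp
  also have "\<dots> = ennreal \<epsilon> * (\<integral>\<^sup>+ z. C z \<partial>\<gamma>)" by (rule nn_integral_cmult) measurable
  finally have "enn2ereal (\<integral>\<^sup>+ z. c z \<partial>\<gamma>) = ereal \<epsilon> * enn2ereal (\<integral>\<^sup>+ z. C z \<partial>\<gamma>)"
    using \<epsilon> by (simp add: times_ennreal.rep_eq enn2ereal_ennreal)
  \<comment> \<open>Scaling by a positive real fixes both infinities, so distributivity holds even
    if \<open>p\<close> and \<open>q\<close> are opposite infinities.\<close>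
  moreover have "ereal \<epsilon> * p + ereal \<epsilon> * q = ereal \<epsilon> * (p + q)" for p q
    using \<epsilon> by (cases p; cases q) (auto simp: distrib_left)
  ultimately show ?thesis by (simp add: entropic_cost_def cost_def)
qed

end

context schroedinger_system
begin

lemma dual_functional_finite:
  assumes C: "C = (\<lambda>z. c z / ennreal \<epsilon>)" and \<epsilon>: "0 < \<epsilon>"
    and I: "(\<integral>\<^sup>+ z. ennreal (gibbs (\<lambda>x. u x / \<epsilon>) (\<lambda>y. v y / \<epsilon>) z) \<partial>(M \<Otimes>\<^sub>M N)) = ennreal I" "0 \<le> I"
  shows "dual_functional M N c \<epsilon> u v =
    ereal (\<epsilon> * ((\<integral>x. u x / \<epsilon> \<partial>M) + (\<integral>y. v y / \<epsilon> \<partial>N) - I + 1))"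
  using I \<epsilon> by (simp add: dual_functional_def gibbs_kernel_scaled[OF C \<epsilon>] enn2ereal_ennreal algebra_simps add_divide_distrib)

lemma gibbs_AE_shift:
  assumes "AE x in M. u x = a x + t" "AE y in N. v y = b y - t"
  shows "AE z in M \<Otimes>\<^sub>M N. gibbs u v z = gibbs a b z"
  using AE_pair_fst[OF assms(1)] AE_pair_snd[OF assms(2)] by eventually_elim (simp add: gibbs_def)

lemma nn_integral_gibbs: "(\<integral>\<^sup>+ z. ennreal (gibbs a b z) \<partial>(M \<Otimes>\<^sub>M N)) = 1"
  using nn_integral_gibbs_plan[of a b] prob_space.emeasure_space_1[OF prob_space_plan] by simp

text \<open>If the Gibbs mass is infinite, the value is minus infinity and equality cannot occur;
  otherwise \<open>dual_optimal\<close> applies to the potentials divided by \<epsilon>. Conversely,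
  opposite shifts change neither the Gibbs density nor the sum of the means.\<close>

lemma dual_functional_le:
  assumes C: "C = (\<lambda>z. c z / ennreal \<epsilon>)" and \<epsilon>: "0 < \<epsilon>"
    and u: "integrable M u" and v: "integrable N v"
  shows "dual_functional M N c \<epsilon> u v \<le> ereal (\<epsilon> * opt_value)"
    and "dual_functional M N c \<epsilon> u v = ereal (\<epsilon> * opt_value) \<longleftrightarrow>
      (\<exists>t. (AE x in M. u x = \<epsilon> * a x + t) \<and> (AE y in N. v y = \<epsilon> * b y - t))"
proof -
  let ?u = "\<lambda>x. u x / \<epsilon>" and ?v = "\<lambda>y. v y / \<epsilon>"
  let ?E = "\<integral>\<^sup>+ z. ennreal (gibbs ?u ?v z) \<partial>(M \<Otimes>\<^sub>M N)"
  have iu: "integrable M ?u" and iv: "integrable N ?v" using u v by simp_all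
  have "dual_functional M N c \<epsilon> u v \<le> ereal (\<epsilon> * opt_value) \<and>
    (dual_functional M N c \<epsilon> u v = ereal (\<epsilon> * opt_value) \<longrightarrow>
      (\<exists>t. (AE x in M. u x = \<epsilon> * a x + t) \<and> (AE y in N. v y = \<epsilon> * b y - t)))"
  proof (cases ?E rule: ennreal_cases)
    case (real I)
    note d = dual_functional_finite[OF C \<epsilon> real(2,1)]
    note o = dual_optimal[OF iu iv real(2,1)]
    show ?thesis
    proof (intro conjI impI)
      show "dual_functional M N c \<epsilon> u v \<le> ereal (\<epsilon> * opt_value)"
        unfolding d opt_value_def ereal_less_eq
        using o(1) \<epsilon> by (intro mult_left_mono) linarith+
      assume "dual_functional M N c \<epsilon> u v = ereal (\<epsilon> * opt_value)"
      then have "\<epsilon> * ((\<integral>x. ?u x \<partial>M) + (\<integral>y. ?v y \<partial>N) - I + 1) = \<epsilon> * opt_value"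
        unfolding d by (simp only: ereal.inject)
      then have "(\<integral>x. ?u x \<partial>M) + (\<integral>y. ?v y \<partial>N) - I + 1 = opt_value"
        using \<epsilon> by (simp only: mult_cancel_left) simp
      then have "(\<integral>x. ?u x \<partial>M) + (\<integral>y. ?v y \<partial>N) - I = (\<integral>x. a x \<partial>M) + (\<integral>y. b y \<partial>N) - 1"
        unfolding opt_value_def by linarith
      from o(2)[OF this] obtain t where t: "AE x in M. ?u x = a x + t" "AE y in N. ?v y = b y - t"
        by blast
      have "AE x in M. u x = \<epsilon> * a x + \<epsilon> * t"
        using t(1) by eventually_elim (use \<epsilon> in \<open>simp add: field_simps\<close>)
      moreover have "AE y in N. v y = \<epsilon> * b y - \<epsilon> * t"
        using t(2) by eventually_elim (use \<epsilon> in \<open>simp add: field_simps\<close>)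
      ultimately show "\<exists>t. (AE x in M. u x = \<epsilon> * a x + t) \<and> (AE y in N. v y = \<epsilon> * b y - t)" by blast
    qed
  next
    case top
    then have "dual_functional M N c \<epsilon> u v = - \<infinity>"
      using \<epsilon> by (simp add: dual_functional_def gibbs_kernel_scaled[OF C \<epsilon>])
    then show ?thesis by simp
  qed
  moreover have "dual_functional M N c \<epsilon> u v = ereal (\<epsilon> * opt_value)"
    if t: "AE x in M. u x = \<epsilon> * a x + t" "AE y in N. v y = \<epsilon> * b y - t" for t
  proof -
    have ut: "AE x in M. ?u x = a x + t / \<epsilon>"
      using t(1) by eventually_elim (use \<epsilon> in \<open>simp add: field_simps\<close>)
    have vt: "AE y in N. ?v y = b y - t / \<epsilon>"
      using t(2) by eventually_elim (use \<epsilon> in \<open>simp add: field_simps\<close>)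
    have "?E = (\<integral>\<^sup>+ z. ennreal (gibbs a b z) \<partial>(M \<Otimes>\<^sub>M N))"
      using gibbs_AE_shift[OF ut vt] by (intro nn_integral_cong_AE) auto
    then have "?E = ennreal 1" by (simp add: nn_integral_gibbs)
    from dual_functional_finite[OF C \<epsilon> this]
    have "dual_functional M N c \<epsilon> u v = ereal (\<epsilon> * ((\<integral>x. ?u x \<partial>M) + (\<integral>y. ?v y \<partial>N)))" by simp
    moreover have "(\<integral>x. ?u x \<partial>M) = (\<integral>x. a x + t / \<epsilon> \<partial>M)"
      by (rule integral_cong_AE) (use iu ut in auto)
    moreover have "(\<integral>y. ?v y \<partial>N) = (\<integral>y. b y - t / \<epsilon> \<partial>N)"
      by (rule integral_cong_AE) (use iv vt in auto)
    ultimately show ?thesis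
      using integrable_a integrable_b by (simp add: opt_value_def M.prob_space N.prob_space)
  qed
  ultimately show "dual_functional M N c \<epsilon> u v \<le> ereal (\<epsilon> * opt_value)"
    "dual_functional M N c \<epsilon> u v = ereal (\<epsilon> * opt_value) \<longleftrightarrow>
      (\<exists>t. (AE x in M. u x = \<epsilon> * a x + t) \<and> (AE y in N. v y = \<epsilon> * b y - t))" by blast+
qed

lemma dual_maximizer_iff:
  assumes C: "C = (\<lambda>z. c z / ennreal \<epsilon>)" and \<epsilon>: "0 < \<epsilon>"
  shows "dual_maximizer M N c \<epsilon> u v \<longleftrightarrow> integrable M u \<and> integrable N v \<and>
    (\<exists>t. (AE x in M. u x = \<epsilon> * a x + t) \<and> (AE y in N. v y = \<epsilon> * b y - t))"
proof -
  have i: "integrable M (\<lambda>x. \<epsilon> * a x)" "integrable N (\<lambda>y. \<epsilon> * b y)"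
    using integrable_a integrable_b by simp_all
  have "\<exists>t. (AE x in M. \<epsilon> * a x = \<epsilon> * a x + t) \<and> (AE y in N. \<epsilon> * b y = \<epsilon> * b y - t)"
    by (rule exI[of _ 0]) simp
  then have opt: "dual_functional M N c \<epsilon> (\<lambda>x. \<epsilon> * a x) (\<lambda>y. \<epsilon> * b y) = ereal (\<epsilon> * opt_value)"
    using dual_functional_le(2)[OF C \<epsilon> i] by simp
  have "dual_maximizer M N c \<epsilon> u v \<longleftrightarrow> integrable M u \<and> integrable N v \<and>
      dual_functional M N c \<epsilon> u v = ereal (\<epsilon> * opt_value)"
  proof
    assume m: "dual_maximizer M N c \<epsilon> u v"
    then have uv: "integrable M u" "integrable N v"
      by (auto simp: dual_maximizer_def is_arg_max_def L1_def)
    have "\<not> dual_functional M N c \<epsilon> u v < dual_functional M N c \<epsilon> (\<lambda>x. \<epsilon> * a x) (\<lambda>y. \<epsilon> * b y)"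
      using m i by (auto simp: dual_maximizer_def is_arg_max_def L1_def)
    then show "integrable M u \<and> integrable N v \<and> dual_functional M N c \<epsilon> u v = ereal (\<epsilon> * opt_value)"
      using dual_functional_le(1)[OF C \<epsilon> uv] uv by (simp add: opt antisym not_less)
  next
    assume r: "integrable M u \<and> integrable N v \<and> dual_functional M N c \<epsilon> u v = ereal (\<epsilon> * opt_value)"
    then show "dual_maximizer M N c \<epsilon> u v"
      using dual_functional_le(1)[OF C \<epsilon>]
      by (auto simp: dual_maximizer_def is_arg_max_def L1_def not_less)
  qed
  then show ?thesis using dual_functional_le(2)[OF C \<epsilon>] by blast
qed

text \<open>Multiplying the integral inside the transform by \<open>exp (u x / \<epsilon>)\<close>
  produces the first marginal of the Gibbs density, which is 1; the constants \<open>t\<close> and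
  \<open>- t\<close> cancel. Solving for \<open>u x\<close> is \<open>elog_eqI\<close>.\<close>

lemma transform_snd_eq:
  assumes C: "C = (\<lambda>z. c z / ennreal \<epsilon>)" and \<epsilon>: "0 < \<epsilon>" and v [measurable]: "v \<in> borel_measurable N"
    and u: "AE x in M. u x = \<epsilon> * a x + t" and vt: "AE y in N. v y = \<epsilon> * b y - t"
  shows "AE x in M. ereal (u x) = transform_snd N c \<epsilon> v x"
  using AE_space u gibbs_fst
proof eventually_elim
  case (elim x)
  note [measurable] = elim(1)
  \<comment> \<open>The integrand of the transform is the Gibbs kernel whose first potential is
    0.\<close>
  have "ennreal (exp (u x / \<epsilon>)) * (\<integral>\<^sup>+ y. eexp ((ereal (v y) - enn2ereal (c (x, y))) / ereal \<epsilon>) \<partial>N)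
      = ennreal (exp (u x / \<epsilon>)) * (\<integral>\<^sup>+ y. ennreal (gibbs (\<lambda>_. 0) (\<lambda>y. v y / \<epsilon>) (x, y)) \<partial>N)"
    using gibbs_kernel_scaled[OF C \<epsilon>, of "\<lambda>_. 0" v "(x, _)"] by (simp add: gibbs_kernel_def)
  also have "\<dots> = (\<integral>\<^sup>+ y. ennreal (exp (u x / \<epsilon>)) * ennreal (gibbs (\<lambda>_. 0) (\<lambda>y. v y / \<epsilon>) (x, y)) \<partial>N)"
    by (rule nn_integral_cmult[symmetric]) (simp add: gibbs_def)
  also have "\<dots> = (\<integral>\<^sup>+ y. ennreal (gibbs a b (x, y)) \<partial>N)"
  proof (rule nn_integral_cong_AE)
    show "AE y in N. ennreal (exp (u x / \<epsilon>)) * ennreal (gibbs (\<lambda>_. 0) (\<lambda>y. v y / \<epsilon>) (x, y))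
        = ennreal (gibbs a b (x, y))"
      using vt
    proof eventually_elim
      fix y assume y: "v y = \<epsilon> * b y - t"
      have "a x + b y = u x / \<epsilon> + v y / \<epsilon>" using \<epsilon> elim(2) y by (simp add: field_simps)
      then show "ennreal (exp (u x / \<epsilon>)) * ennreal (gibbs (\<lambda>_. 0) (\<lambda>y. v y / \<epsilon>) (x, y))
        = ennreal (gibbs a b (x, y))"
        by (simp add: gibbs_def exp_add mult.assoc flip: ennreal_mult')
    qed
  qed
  finally show ?case unfolding transform_snd_def using elim(3) \<epsilon> by (intro elog_eqI) auto
qed

lemma transform_fst_eq:
  assumes C: "C = (\<lambda>z. c z / ennreal \<epsilon>)" and \<epsilon>: "0 < \<epsilon>" and u [measurable]: "u \<in> borel_measurable M"
    and ut: "AE x in M. u x = \<epsilon> * a x + t" and v: "AE y in N. v y = \<epsilon> * b y - t"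
  shows "AE y in N. ereal (v y) = transform_fst M c \<epsilon> u y"
  using AE_space v gibbs_snd
proof eventually_elim
  case (elim y)
  note [measurable] = elim(1)
  have "ennreal (exp (v y / \<epsilon>)) * (\<integral>\<^sup>+ x. eexp ((ereal (u x) - enn2ereal (c (x, y))) / ereal \<epsilon>) \<partial>M)
      = ennreal (exp (v y / \<epsilon>)) * (\<integral>\<^sup>+ x. ennreal (gibbs (\<lambda>x. u x / \<epsilon>) (\<lambda>_. 0) (x, y)) \<partial>M)"
    using gibbs_kernel_scaled[OF C \<epsilon>, of u "\<lambda>_. 0" "(_, y)"] by (simp add: gibbs_kernel_def)
  also have "\<dots> = (\<integral>\<^sup>+ x. ennreal (exp (v y / \<epsilon>)) * ennreal (gibbs (\<lambda>x. u x / \<epsilon>) (\<lambda>_. 0) (x, y)) \<partial>M)"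
    by (rule nn_integral_cmult[symmetric]) (simp add: gibbs_def)
  also have "\<dots> = (\<integral>\<^sup>+ x. ennreal (gibbs a b (x, y)) \<partial>M)"
  proof (rule nn_integral_cong_AE)
    show "AE x in M. ennreal (exp (v y / \<epsilon>)) * ennreal (gibbs (\<lambda>x. u x / \<epsilon>) (\<lambda>_. 0) (x, y))
        = ennreal (gibbs a b (x, y))"
      using ut
    proof eventually_elim
      fix x assume x: "u x = \<epsilon> * a x + t"
      have "a x + b y = v y / \<epsilon> + u x / \<epsilon>" using \<epsilon> elim(2) x by (simp add: field_simps)
      then show "ennreal (exp (v y / \<epsilon>)) * ennreal (gibbs (\<lambda>x. u x / \<epsilon>) (\<lambda>_. 0) (x, y))
        = ennreal (gibbs a b (x, y))"
        by (simp add: gibbs_def exp_add mult.assoc flip: ennreal_mult')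
    qed
  qed
  finally show ?case unfolding transform_fst_def using elim(3) \<epsilon> by (intro elog_eqI) auto
qed

text \<open>The opposite constants cancel in the density, so the plan does not depend on the choice
  of the maximizer.\<close>

lemma entropic_plan_eq:
  assumes C: "C = (\<lambda>z. c z / ennreal \<epsilon>)" and \<epsilon>: "0 < \<epsilon>"
    and [measurable]: "u \<in> borel_measurable M" "v \<in> borel_measurable N"
    and t: "AE x in M. u x = \<epsilon> * a x + t" "AE y in N. v y = \<epsilon> * b y - t"
  shows "entropic_plan M N c \<epsilon> u v = plan a b"
proof -
  have ut: "AE x in M. u x / \<epsilon> = a x + t / \<epsilon>"
    using t(1) by eventually_elim (use \<epsilon> in \<open>simp add: field_simps\<close>)
  have vt: "AE y in N. v y / \<epsilon> = b y - t / \<epsilon>"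
    using t(2) by eventually_elim (use \<epsilon> in \<open>simp add: field_simps\<close>)
  have "AE z in M \<Otimes>\<^sub>M N. gibbs (\<lambda>x. u x / \<epsilon>) (\<lambda>y. v y / \<epsilon>) z = gibbs a b z"
    by (rule gibbs_AE_shift[OF ut vt])
  then have "AE z in M \<Otimes>\<^sub>M N. gibbs_kernel c \<epsilon> u v z = ennreal (gibbs a b z)"
    by eventually_elim (simp add: gibbs_kernel_scaled[OF C \<epsilon>])
  then show ?thesis
    unfolding entropic_plan_def plan_def
    by (intro density_cong) (simp_all add: gibbs_kernel_scaled[OF C \<epsilon>, abs_def])
qed

end

section \<open>Duality and uniqueness for Borel measures on Polish spaces\<close>

theorem corollary2p11:
  fixes \<mu> :: "'a::polish_space measure" and \<nu> :: "'b::polish_space measure"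
    and c :: "'a \<times> 'b \<Rightarrow> ennreal" and K :: ennreal and \<epsilon> :: real
  assumes "prob_space \<mu>" and "sets \<mu> = sets borel"
    and "prob_space \<nu>" and "sets \<nu> = sets borel"
    and "lower_semicontinuous c"
    and "K < \<infinity>"
    and "(SUP y. \<integral>\<^sup>+ x. c (x, y) \<partial>\<mu>) \<le> K"
    and "(SUP x. \<integral>\<^sup>+ y. c (x, y) \<partial>\<nu>) \<le> K"
    and "\<epsilon> > 0"
  shows "(\<exists>u v. dual_maximizer \<mu> \<nu> c \<epsilon> u v) \<and>
    (\<forall>u v. dual_maximizer \<mu> \<nu> c \<epsilon> u v \<longrightarrow>
      (\<forall>u'\<in>L1 \<mu>. \<forall>v'\<in>L1 \<nu>. dual_maximizer \<mu> \<nu> c \<epsilon> u' v' \<longleftrightarrow>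
         (\<exists>a::real. (AE x in \<mu>. u' x = u x + a) \<and> (AE y in \<nu>. v' y = v y - a))) \<and>
      (AE x in \<mu>. ereal (u x) = transform_snd \<nu> c \<epsilon> v x) \<and>
      (AE y in \<nu>. ereal (v y) = transform_fst \<mu> c \<epsilon> u y) \<and>
      entropic_plan \<mu> \<nu> c \<epsilon> u v \<in> couplings \<mu> \<nu> \<and>
      (\<forall>\<gamma>. is_arg_min (entropic_cost \<mu> \<nu> c \<epsilon>) (\<lambda>\<gamma>. \<gamma> \<in> couplings \<mu> \<nu>) \<gamma> \<longleftrightarrow>
         \<gamma> = entropic_plan \<mu> \<nu> c \<epsilon> u v) \<and>
      entropic_cost \<mu> \<nu> c \<epsilon> (entropic_plan \<mu> \<nu> c \<epsilon> u v) = dual_functional \<mu> \<nu> c \<epsilon> u v) \<and>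
    (INF \<gamma>\<in>couplings \<mu> \<nu>. entropic_cost \<mu> \<nu> c \<epsilon> \<gamma>) =
      (SUP (u, v)\<in>L1 \<mu> \<times> L1 \<nu>. dual_functional \<mu> \<nu> c \<epsilon> u v)"
proof -
  interpret M: prob_space \<mu> by fact
  interpret N: prob_space \<nu> by fact
  note \<epsilon> = \<open>0 < \<epsilon>\<close>
  have sM [measurable_cong]: "sets \<mu> = sets borel" and sN [measurable_cong]: "sets \<nu> = sets borel" by fact+
  \<comment> \<open>Second countability identifies the product of the Borel sigma-algebras with the
    Borel sigma-algebra of the product, so Borel measurability of \<open>c\<close> is usable for the
    product measure.\<close>
  have sP: "sets (\<mu> \<Otimes>\<^sub>M \<nu>) = sets borel"
    unfolding borel_prod[symmetric] by (rule sets_pair_measure_cong[OF sM sN])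
  have c_meas [measurable]: "c \<in> borel_measurable (\<mu> \<Otimes>\<^sub>M \<nu>)"
    using lower_semicontinuous_measurable[OF \<open>lower_semicontinuous c\<close>] by (simp cong: measurable_cong_sets add: sP)
  obtain k where k: "K = ennreal k" "0 \<le> k"
    using \<open>K < \<infinity>\<close> by (cases K rule: ennreal_cases) auto
  define C where "C = (\<lambda>z. c z / ennreal \<epsilon>)"
  have C_meas: "C \<in> borel_measurable (\<mu> \<Otimes>\<^sub>M \<nu>)" unfolding C_def by measurable
  have scale: "t / ennreal \<epsilon> \<le> ennreal (k / \<epsilon>)" if "t \<le> K" for t
    using that \<epsilon> k divide_right_mono_ennreal[of t K "ennreal \<epsilon>"] by (simp add: divide_ennreal)
  interpret entropic_transport \<mu> \<nu> C "k / \<epsilon>"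
  proof
    fix y assume [measurable]: "y \<in> space \<nu>"
    have "(\<integral>\<^sup>+ x. C (x, y) \<partial>\<mu>) = (\<integral>\<^sup>+ x. c (x, y) \<partial>\<mu>) / ennreal \<epsilon>"
      unfolding C_def by (rule nn_integral_divide) measurable
    also have "\<dots> \<le> ennreal (k / \<epsilon>)"
      using assms(7) by (intro scale) (simp add: SUP_le_iff)
    finally show "(\<integral>\<^sup>+ x. C (x, y) \<partial>\<mu>) \<le> ennreal (k / \<epsilon>)" .
  next
    fix x assume [measurable]: "x \<in> space \<mu>"
    have "(\<integral>\<^sup>+ y. C (x, y) \<partial>\<nu>) = (\<integral>\<^sup>+ y. c (x, y) \<partial>\<nu>) / ennreal \<epsilon>"
      unfolding C_def by (rule nn_integral_divide) measurable
    also have "\<dots> \<le> ennreal (k / \<epsilon>)"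
      using assms(8) by (intro scale) (simp add: SUP_le_iff)
    finally show "(\<integral>\<^sup>+ y. C (x, y) \<partial>\<nu>) \<le> ennreal (k / \<epsilon>)" .
  qed (use C_meas \<epsilon> k in auto)
  obtain a b R where "schroedinger_system \<mu> \<nu> C (k / \<epsilon>) a b R"
    by (rule bounded_schroedinger_exists)
  then interpret schroedinger_system \<mu> \<nu> C "k / \<epsilon>" a b R .
  \<comment> \<open>Undoing the division by \<epsilon>: this pair witnesses existence and is the
    reference to which every maximizer is compared.\<close>
  let ?A = "\<lambda>x. \<epsilon> * a x" and ?B = "\<lambda>y. \<epsilon> * b y"
  have couplings: "\<gamma> \<in> couplings \<mu> \<nu> \<longleftrightarrow> coupling \<gamma>" for \<gamma>
  proof -
    have "distr \<gamma> borel fst = distr \<gamma> \<mu> fst" "distr \<gamma> borel snd = distr \<gamma> \<nu> snd"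
      by (auto intro!: distr_cong simp: sM sN)
    then show ?thesis by (simp add: couplings_def coupling_def sP)
  qed
  have max_iff: "dual_maximizer \<mu> \<nu> c \<epsilon> u v \<longleftrightarrow> integrable \<mu> u \<and> integrable \<nu> v \<and>
      (\<exists>t. (AE x in \<mu>. u x = ?A x + t) \<and> (AE y in \<nu>. v y = ?B y - t))" for u v
    by (rule dual_maximizer_iff[OF C_def \<epsilon>])
  have iAB: "integrable \<mu> ?A" "integrable \<nu> ?B" using integrable_a integrable_b by simp_all
  have maxAB: "dual_maximizer \<mu> \<nu> c \<epsilon> ?A ?B"
    unfolding max_iff using iAB by (auto intro!: exI[of _ 0])
  have dualAB: "dual_functional \<mu> \<nu> c \<epsilon> ?A ?B = ereal (\<epsilon> * opt_value)"
    using maxAB dual_functional_le(2)[OF C_def \<epsilon> iAB] unfolding max_iff by simp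
  have cost: "entropic_cost \<mu> \<nu> c \<epsilon> \<gamma> = ereal \<epsilon> * cost \<gamma>" if "\<gamma> \<in> couplings \<mu> \<nu>" for \<gamma>
    using that by (intro entropic_cost_scaled[OF C_def \<epsilon>]) (simp add: couplings coupling_def)
  have plan: "plan a b \<in> couplings \<mu> \<nu>" by (simp add: couplings coupling_plan)
  have cost_opt: "entropic_cost \<mu> \<nu> c \<epsilon> (plan a b) = ereal (\<epsilon> * opt_value)"
    using cost[OF plan] by (simp add: cost_plan)
  have cost_ge: "ereal (\<epsilon> * opt_value) \<le> entropic_cost \<mu> \<nu> c \<epsilon> \<gamma>" if "\<gamma> \<in> couplings \<mu> \<nu>" for \<gamma>
    using that coupling_cost(1)[of \<gamma>] \<epsilon> ereal_mult_left_mono[of "ereal opt_value" "cost \<gamma>" "ereal \<epsilon>"]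
    by (simp add: cost couplings)
  have cost_eq: "\<gamma> = plan a b"
    if "\<gamma> \<in> couplings \<mu> \<nu>" "entropic_cost \<mu> \<nu> c \<epsilon> \<gamma> = ereal (\<epsilon> * opt_value)" for \<gamma>
  proof -
    have "cost \<gamma> = ereal opt_value"
      using that(2) cost[OF that(1)] \<epsilon> by (cases "cost \<gamma>") auto
    then show ?thesis using coupling_cost(2) that(1) by (simp add: couplings)
  qed
  have argmin: "is_arg_min (entropic_cost \<mu> \<nu> c \<epsilon>) (\<lambda>\<gamma>. \<gamma> \<in> couplings \<mu> \<nu>) \<gamma> \<longleftrightarrow> \<gamma> = plan a b" for \<gamma>
  proof
    assume m: "is_arg_min (entropic_cost \<mu> \<nu> c \<epsilon>) (\<lambda>\<gamma>. \<gamma> \<in> couplings \<mu> \<nu>) \<gamma>"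
    then have g: "\<gamma> \<in> couplings \<mu> \<nu>" and "\<not> entropic_cost \<mu> \<nu> c \<epsilon> (plan a b) < entropic_cost \<mu> \<nu> c \<epsilon> \<gamma>"
      using plan by (auto simp: is_arg_min_def)
    then have "entropic_cost \<mu> \<nu> c \<epsilon> \<gamma> = ereal (\<epsilon> * opt_value)"
      using cost_ge[OF g] by (simp add: cost_opt antisym not_less)
    then show "\<gamma> = plan a b" by (rule cost_eq[OF g])
  next
    assume "\<gamma> = plan a b"
    then show "is_arg_min (entropic_cost \<mu> \<nu> c \<epsilon>) (\<lambda>\<gamma>. \<gamma> \<in> couplings \<mu> \<nu>) \<gamma>"
      using plan cost_ge by (auto simp: is_arg_min_def cost_opt not_less)
  qed
  have inf: "(INF \<gamma>\<in>couplings \<mu> \<nu>. entropic_cost \<mu> \<nu> c \<epsilon> \<gamma>) = ereal (\<epsilon> * opt_value)"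
  proof (rule antisym)
    show "(INF \<gamma>\<in>couplings \<mu> \<nu>. entropic_cost \<mu> \<nu> c \<epsilon> \<gamma>) \<le> ereal (\<epsilon> * opt_value)"
      using INF_lower[OF plan, of "entropic_cost \<mu> \<nu> c \<epsilon>"] by (simp add: cost_opt)
  qed (rule INF_greatest, rule cost_ge)
  have sup: "(SUP (u, v)\<in>L1 \<mu> \<times> L1 \<nu>. dual_functional \<mu> \<nu> c \<epsilon> u v) = ereal (\<epsilon> * opt_value)"
  proof (rule antisym)
    show "(SUP (u, v)\<in>L1 \<mu> \<times> L1 \<nu>. dual_functional \<mu> \<nu> c \<epsilon> u v) \<le> ereal (\<epsilon> * opt_value)"
      using dual_functional_le(1)[OF C_def \<epsilon>] by (intro SUP_least) (auto simp: L1_def)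
    have "(?A, ?B) \<in> L1 \<mu> \<times> L1 \<nu>" using iAB by (simp add: L1_def)
    from SUP_upper[OF this, of "\<lambda>(u, v). dual_functional \<mu> \<nu> c \<epsilon> u v"]
    show "ereal (\<epsilon> * opt_value) \<le> (SUP (u, v)\<in>L1 \<mu> \<times> L1 \<nu>. dual_functional \<mu> \<nu> c \<epsilon> u v)"
      by (simp add: dualAB)
  qed
  show ?thesis
  proof (intro conjI allI impI)
    show "\<exists>u v. dual_maximizer \<mu> \<nu> c \<epsilon> u v" using maxAB by blast
    fix u v assume m: "dual_maximizer \<mu> \<nu> c \<epsilon> u v"
    then obtain t where iuv: "integrable \<mu> u" "integrable \<nu> v"
      and t: "AE x in \<mu>. u x = ?A x + t" "AE y in \<nu>. v y = ?B y - t"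
      unfolding max_iff by blast
    have plan_eq: "entropic_plan \<mu> \<nu> c \<epsilon> u v = plan a b"
      using iuv t by (intro entropic_plan_eq[OF C_def \<epsilon>]) auto
    show "\<forall>u'\<in>L1 \<mu>. \<forall>v'\<in>L1 \<nu>. dual_maximizer \<mu> \<nu> c \<epsilon> u' v' \<longleftrightarrow>
         (\<exists>s::real. (AE x in \<mu>. u' x = u x + s) \<and> (AE y in \<nu>. v' y = v y - s))"
    proof (intro ballI)
      fix u' v' assume "u' \<in> L1 \<mu>" "v' \<in> L1 \<nu>"
      then have i': "integrable \<mu> u'" "integrable \<nu> v'" by (simp_all add: L1_def)
      show "dual_maximizer \<mu> \<nu> c \<epsilon> u' v' \<longleftrightarrow>
         (\<exists>s::real. (AE x in \<mu>. u' x = u x + s) \<and> (AE y in \<nu>. v' y = v y - s))"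
      proof
        assume "dual_maximizer \<mu> \<nu> c \<epsilon> u' v'"
        then obtain s where s: "AE x in \<mu>. u' x = ?A x + s" "AE y in \<nu>. v' y = ?B y - s"
          unfolding max_iff by blast
        have "AE x in \<mu>. u' x = u x + (s - t)" using s(1) t(1) by eventually_elim simp
        moreover have "AE y in \<nu>. v' y = v y - (s - t)" using s(2) t(2) by eventually_elim simp
        ultimately show "\<exists>s. (AE x in \<mu>. u' x = u x + s) \<and> (AE y in \<nu>. v' y = v y - s)" by blast
      next
        assume "\<exists>s. (AE x in \<mu>. u' x = u x + s) \<and> (AE y in \<nu>. v' y = v y - s)"
        then obtain s where s: "AE x in \<mu>. u' x = u x + s" "AE y in \<nu>. v' y = v y - s" by blast
        have "AE x in \<mu>. u' x = ?A x + (t + s)" using s(1) t(1) by eventually_elim simp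
        moreover have "AE y in \<nu>. v' y = ?B y - (t + s)" using s(2) t(2) by eventually_elim simp
        ultimately show "dual_maximizer \<mu> \<nu> c \<epsilon> u' v'" unfolding max_iff using i' by blast
      qed
    qed
    show "AE x in \<mu>. ereal (u x) = transform_snd \<nu> c \<epsilon> v x"
      using iuv t by (intro transform_snd_eq[OF C_def \<epsilon>]) auto
    show "AE y in \<nu>. ereal (v y) = transform_fst \<mu> c \<epsilon> u y"
      using iuv t by (intro transform_fst_eq[OF C_def \<epsilon>]) auto
    show "entropic_plan \<mu> \<nu> c \<epsilon> u v \<in> couplings \<mu> \<nu>" unfolding plan_eq by (rule plan)
    show "is_arg_min (entropic_cost \<mu> \<nu> c \<epsilon>) (\<lambda>\<gamma>. \<gamma> \<in> couplings \<mu> \<nu>) \<gamma> \<longleftrightarrow>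
         \<gamma> = entropic_plan \<mu> \<nu> c \<epsilon> u v" for \<gamma>
      unfolding plan_eq by (rule argmin)
    show "entropic_cost \<mu> \<nu> c \<epsilon> (entropic_plan \<mu> \<nu> c \<epsilon> u v) = dual_functional \<mu> \<nu> c \<epsilon> u v"
      using dual_functional_le(2)[OF C_def \<epsilon> iuv] t unfolding plan_eq cost_opt by metis
  next
    show "(INF \<gamma>\<in>couplings \<mu> \<nu>. entropic_cost \<mu> \<nu> c \<epsilon> \<gamma>) =
      (SUP (u, v)\<in>L1 \<mu> \<times> L1 \<nu>. dual_functional \<mu> \<nu> c \<epsilon> u v)"
      unfolding inf sup ..
  qed
qed

end
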